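(* Let $m\ge 0$ be an integer and let $a,b,c$ be complex constants with $|a|=1$, $\bar a b+\bar b=0$, $|c|^2e^{|b|^2}=1$. Let $A,B,C,D$ be complex constants with $C\ne 0$, and put $$\psi(z)=Ce^{Dz},\quad \varphi(z)=Az+B,\quad \phi(z)=(aAz+aB+b)^m,$$ $$\widehat\psi(z)=\overline{C}e^{\overline{B}z},\quad \widehat\varphi(z)=\overline{A}z+\overline{D},\quad \widehat\phi(z)=(\overline{A}z+\overline{D})^m,\qquad z\in\mathbb{C}.$$ Let $\mathbb{S}_{\max}$ be the maximal multi-valued weighted composition operator on $\mathcal{F}^2$ induced by $\psi\cdot f\circ\varphi=\phi\cdot g^{(m)}$, and let $\widehat{\mathbb{S}}_{\max}$ be the multi-valued linear operator on $\mathcal{F}^2$ whose graph consists of all pairs $(f,g)\in\mathcal{F}^2\times\mathcal{F}^2$ satisfying $$\widehat\psi(z)f(\widehat\varphi(z))=\widehat\phi(z)\sum_{j=0}^m\binom{m}{j}\overline{a}^{\,j}\,\overline{b}^{\,m-j}g^{(j)}(z),\qquad z\in\mathbb{C}.$$ Then $\mathbb{S}_{\max}^*=\widehat{\mathbb{S}}_{\max}$.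
   Context: Fock space $\mathcal{F}^2$ is the Hilbert space of entire functions $f$ with $\int_{\mathbb{C}}|f(z)|^2e^{-|z|^2}dV(z)<\infty$, with inner product $\langle f,g\rangle=\frac1\pi\int_{\mathbb{C}}f(z)\overline{g(z)}e^{-|z|^2}dV(z)$, where $dV$ is area measure. A multi-valued linear operator $\mathbb{A}$ on a Hilbert space $\mathcal{H}$ assigns to each $x$ in a subspace $\mathrm{dom}(\mathbb{A})\subset\mathcal{H}$ a nonempty subset $\mathbb{A}(x)\subset\mathcal{H}$ such that its graph $G(\mathbb{A})=\{(x,y):x\in\mathrm{dom}(\mathbb{A}),\,y\in\mathbb{A}(x)\}$ is a linear subspace of $\mathcal{H}\times\mathcal{H}$; $\mathbb{A}$ is determined by $G(\mathbb{A})$. The operator $\mathbb{S}_{\max}$ is given by $G(\mathbb{S}_{\max})=\{(f,g)\in\mathcal{F}^2\times\mathcal{F}^2:\psi(z)f(\varphi(z))=\phi(z)g^{(m)}(z)\ \forall z\in\mathbb{C}\}$. The adjoint $\mathbb{A}^*$ is given by $G(\mathbb{A}^* )=\{(u,v):\langle g,u\rangle=\langle f,v\rangle\ \forall (f,g)\in G(\mathbb{A})\}$. Zeroth powers are read as $1$.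
   Formalization: The formal theorem adds the hypothesis that A ≠ 0 or m = 0; for A = 0 and m ≥ 1 the printed claim is false (e.g. m = 1, a = c = C = 1, b = A = B = D = 0), and it fails for all values of the other constants. *)

theory Defs
  imports "HOL-Complex_Analysis.Complex_Analysis"
begin

definition fock_space :: "(complex \<Rightarrow> complex) set" where
  "fock_space = {f. f holomorphic_on UNIV \<and>
     integrable lborel (\<lambda>z. (cmod (f z))\<^sup>2 * exp (- (cmod z)\<^sup>2))}"

definition fock_inner :: "(complex \<Rightarrow> complex) \<Rightarrow> (complex \<Rightarrow> complex) \<Rightarrow> complex" where
  "fock_inner f g =
     of_real (1 / pi) * (LINT z|lborel. f z * cnj (g z) * of_real (exp (- (cmod z)\<^sup>2)))"

text \<open>
  A multi-valued linear operator is identified with its graph. Its domain is the set of first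
  components of the graph, and its value at \<open>f\<close> is the set of all \<open>g\<close> with \<open>(f, g)\<close> in the graph.
\<close>

type_synonym fock_rel = "((complex \<Rightarrow> complex) \<times> (complex \<Rightarrow> complex)) set"

definition mv_linear_operator :: "fock_rel \<Rightarrow> bool" where
  "mv_linear_operator G \<longleftrightarrow>
     G \<subseteq> fock_space \<times> fock_space \<and>
     ((\<lambda>z. 0), (\<lambda>z. 0)) \<in> G \<and>
     (\<forall>f g h k. (f, g) \<in> G \<longrightarrow> (h, k) \<in> G \<longrightarrow> ((\<lambda>z. f z + h z), (\<lambda>z. g z + k z)) \<in> G) \<and>
     (\<forall>s f g. (f, g) \<in> G \<longrightarrow> ((\<lambda>z. s * f z), (\<lambda>z. s * g z)) \<in> G)"

definition mv_adjoint :: "fock_rel \<Rightarrow> fock_rel" where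
  "mv_adjoint G =
     {(u, v) \<in> fock_space \<times> fock_space. \<forall>(f, g) \<in> G. fock_inner g u = fock_inner f v}"

definition S_max ::
  "nat \<Rightarrow> (complex \<Rightarrow> complex) \<Rightarrow> (complex \<Rightarrow> complex) \<Rightarrow> (complex \<Rightarrow> complex) \<Rightarrow> fock_rel" where
  "S_max m \<psi> \<phi> \<Phi> =
     {(f, g) \<in> fock_space \<times> fock_space. \<forall>z. \<psi> z * f (\<phi> z) = \<Phi> z * (deriv ^^ m) g z}"

definition S_hat_max ::
  "nat \<Rightarrow> complex \<Rightarrow> complex \<Rightarrow>
   (complex \<Rightarrow> complex) \<Rightarrow> (complex \<Rightarrow> complex) \<Rightarrow> (complex \<Rightarrow> complex) \<Rightarrow> fock_rel" where
  "S_hat_max m a b \<psi> \<phi> \<Phi> =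
     {(f, g) \<in> fock_space \<times> fock_space. \<forall>z. \<psi> z * f (\<phi> z) =
        \<Phi> z * (\<Sum>j\<le>m. of_nat (m choose j) * cnj a ^ j * cnj b ^ (m - j) * (deriv ^^ j) g z)}"

lemma fock_space_zero: "(\<lambda>z. 0) \<in> fock_space"
  by (simp add: fock_space_def)

lemma fock_space_add:
  assumes "f \<in> fock_space" "g \<in> fock_space"
  shows "(\<lambda>z. f z + g z) \<in> fock_space"
proof -
  have hol: "f holomorphic_on UNIV" "g holomorphic_on UNIV"
    using assms by (auto simp: fock_space_def)
  have [measurable]: "f \<in> borel_measurable borel" "g \<in> borel_measurable borel"
    using hol by (auto intro!: borel_measurable_continuous_onI holomorphic_on_imp_continuous_on)
  have "integrable lborel (\<lambda>z. 2 * ((cmod (f z))\<^sup>2 * exp (- (cmod z)\<^sup>2))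
          + 2 * ((cmod (g z))\<^sup>2 * exp (- (cmod z)\<^sup>2)))"
    using assms by (auto simp: fock_space_def)
  then have "integrable lborel (\<lambda>z. (cmod (f z + g z))\<^sup>2 * exp (- (cmod z)\<^sup>2))"
  proof (rule Bochner_Integration.integrable_bound)
    show "(\<lambda>z. (cmod (f z + g z))\<^sup>2 * exp (- (cmod z)\<^sup>2)) \<in> borel_measurable lborel"
      by measurable
    have "(cmod (f z + g z))\<^sup>2 \<le> 2 * (cmod (f z))\<^sup>2 + 2 * (cmod (g z))\<^sup>2" for z
    proof -
      have "(cmod (f z + g z))\<^sup>2 \<le> (cmod (f z) + cmod (g z))\<^sup>2"
        by (intro power_mono norm_triangle_ineq) auto
      also have "\<dots> \<le> 2 * (cmod (f z))\<^sup>2 + 2 * (cmod (g z))\<^sup>2"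
        using sum_squares_bound[of "cmod (f z)" "cmod (g z)"] by (simp add: power2_sum)
      finally show ?thesis .
    qed
    then have "(cmod (f z + g z))\<^sup>2 * exp (- (cmod z)\<^sup>2)
        \<le> (2 * (cmod (f z))\<^sup>2 + 2 * (cmod (g z))\<^sup>2) * exp (- (cmod z)\<^sup>2)" for z
      by (intro mult_right_mono) auto
    then show "AE z in lborel. norm ((cmod (f z + g z))\<^sup>2 * exp (- (cmod z)\<^sup>2))
        \<le> norm (2 * ((cmod (f z))\<^sup>2 * exp (- (cmod z)\<^sup>2))
          + 2 * ((cmod (g z))\<^sup>2 * exp (- (cmod z)\<^sup>2)))"
      by (intro AE_I2) (simp add: algebra_simps)
  qed
  then show ?thesis
    using hol by (auto simp: fock_space_def intro!: holomorphic_intros)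
qed

lemma fock_space_scale:
  assumes "f \<in> fock_space"
  shows "(\<lambda>z. s * f z) \<in> fock_space"
  using assms
  by (auto simp: fock_space_def norm_mult power_mult_distrib mult.assoc intro!: holomorphic_intros)

lemma fock_deriv_add:
  assumes "f \<in> fock_space" "g \<in> fock_space"
  shows "(deriv ^^ n) (\<lambda>z. f z + g z) z = (deriv ^^ n) f z + (deriv ^^ n) g z"
  using assms by (intro higher_deriv_add[of _ UNIV]) (auto simp: fock_space_def)

lemma fock_deriv_scale:
  assumes "f \<in> fock_space"
  shows "(deriv ^^ n) (\<lambda>z. s * f z) z = s * (deriv ^^ n) f z"
  using assms by (intro higher_deriv_cmult[of _ UNIV]) (auto simp: fock_space_def)

lemma mv_linear_operator_S_max: "mv_linear_operator (S_max m \<psi> \<phi> \<Phi>)"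
  unfolding mv_linear_operator_def S_max_def
  by (auto simp: fock_space_zero fock_space_add fock_space_scale fock_deriv_add fock_deriv_scale
      algebra_simps)

lemma mv_linear_operator_S_hat_max: "mv_linear_operator (S_hat_max m a b \<psi> \<phi> \<Phi>)"
  unfolding mv_linear_operator_def S_hat_max_def
  by (auto simp: fock_space_zero fock_space_add fock_space_scale fock_deriv_add fock_deriv_scale
      algebra_simps sum.distrib sum_distrib_left)

end

theory Submission
  imports Defs "HOL-Probability.Distributions"
begin

text \<open>
  Write \<open>K\<^sub>w(z) = exp (cnj w z)\<close> for the reproducing kernel and \<open>p(z) = (a z + b)\<^sup>m\<close>. Pairing with \<open>K\<^sub>w\<close>
  evaluates at \<open>w\<close>, pairing with \<open>z\<^sup>n K\<^sub>w\<close> evaluates the \<open>n\<close>-th derivative, and hence pairing with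
  \<open>p K\<^sub>w\<close> evaluates \<open>(cnj a \<partial> + cnj b)\<^sup>m v\<close> at \<open>w\<close>, which is the sum in the definition of
  \<^const>\<open>S_hat_max\<close> (\<open>fock_reproducing\<close>, \<open>fock_reproducing_deriv\<close>, \<open>fock_inner_affine_power\<close>).

  One inclusion is then immediate: the equation that defines the candidate \<^const>\<open>S_hat_max\<close>, taken
  at a point \<open>w\<close>, is the adjoint relation tested against the pair formed by a multiple of
  \<open>p K\<^sub>w\<close> and a multiple of another kernel (\<open>adjoint_subset_S_hat_max\<close>).

  The other inclusion says that these special pairs determine the whole graph, which is delicate because
  \<open>f \<mapsto> exp (D z) f (A z + B)\<close> is in general unbounded and no expansion of \<open>f\<close> in eigenvectors is at
  hand. The idea is to regularise by dilations. If \<open>(f, g)\<close> is in the graph of \<^const>\<open>S_max\<close> and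
  \<open>A \<noteq> 0\<close>, then \<open>f = p h\<close> with \<open>h\<close> entire, and replacing \<open>g\<close> by \<open>g (s z)\<close> with \<open>s < 1\<close>
  corresponds, up to the scalar \<open>s\<^sup>m\<close>, to replacing \<open>h\<close> by
  \<open>exp (- (1 - s) d (z - B)) h (s z + (1 - s) B)\<close>, where \<open>d = D / A\<close>. For \<open>s < 1\<close> both dilated
  functions are power series in \<open>s\<close> that may be integrated term by term (\<open>dilation_series\<close>), with terms
  that are explicit functions of exponential type: monomials on the side of \<open>g\<close>, and
  \<open>p exp (- d (z - B)) (z - B)\<^sup>n\<close> on the side of \<open>f\<close>. For \<open>(u, v)\<close> in the candidate the two series
  of inner products agree term by term, by comparison of Taylor coefficients in the equation for \<open>u\<close>
  and \<open>v\<close>. Thus the adjoint relation holds for all dilated pairs. Since the twisted dilations are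
  bounded in norm and converge pointwise, they converge weakly (\<open>dilation_limit\<close>), and \<open>s \<rightarrow> 1\<close> gives
  the adjoint relation for \<open>(f, g)\<close>. If \<open>A = 0\<close>, then \<open>m = 0\<close> and both operators have one-dimensional
  range.

  The reproducing property rests on the mean value property \<open>\<integral> F(z) exp (- |z|\<^sup>2) = \<pi> F(0)\<close> for entire
  \<open>F\<close>, which follows from rotation invariance of area measure and Cauchy's formula on circles.
\<close>

section \<open>Rotation invariance of area measure\<close>

lemma complex_lborel_eq_distr:
  "(lborel :: complex measure) = distr (lborel \<Otimes>\<^sub>M lborel) borel (\<lambda>(x, y). Complex x y)"
proof (rule lborel_eqI)
  have [measurable]: "(\<lambda>(x, y). Complex x y) \<in> borel_measurable (lborel \<Otimes>\<^sub>M lborel)"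
    unfolding lborel_prod measurable_lborel2 case_prod_beta
    by (intro borel_measurable_continuous_onI continuous_intros)
  fix l u :: complex
  assume lu: "\<And>b. b \<in> Basis \<Longrightarrow> l \<bullet> b \<le> u \<bullet> b"
  have le: "Re l \<le> Re u" "Im l \<le> Im u"
    using lu[of 1] lu[of \<i>] by (auto simp: Basis_complex_def)
  have box: "(\<lambda>(x, y). Complex x y) -` box l u = {Re l<..<Re u} \<times> {Im l<..<Im u}"
    by (auto simp: box_def Basis_complex_def)
  have "emeasure (distr (lborel \<Otimes>\<^sub>M lborel) borel (\<lambda>(x, y). Complex x y)) (box l u)
      = emeasure (lborel \<Otimes>\<^sub>M lborel) ({Re l<..<Re u} \<times> {Im l<..<Im u})"
    by (subst emeasure_distr) (simp_all add: box space_pair_measure)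
  also have "\<dots> = ennreal (Re u - Re l) * ennreal (Im u - Im l)"
    using le by (subst lborel.emeasure_pair_measure_Times) auto
  also have "\<dots> = (\<Prod>b\<in>Basis. (u - l) \<bullet> b)"
    using le by (simp add: Basis_complex_def ennreal_mult)
  finally show "emeasure (distr (lborel \<Otimes>\<^sub>M lborel) borel (\<lambda>(x, y). Complex x y)) (box l u)
      = (\<Prod>b\<in>Basis. (u - l) \<bullet> b)" .
qed simp

lemma emeasure_lborel_translate:
  fixes c :: "'a::euclidean_space"
  assumes [measurable]: "X \<in> sets borel"
  shows "emeasure lborel ((\<lambda>x. x + c) -` X) = emeasure lborel X"
proof -
  have "emeasure lborel X = emeasure (distr lborel borel ((+) c)) X"
    by (simp add: lborel_distr_plus)
  also have "\<dots> = emeasure lborel ((\<lambda>x. x + c) -` X)"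
    by (subst emeasure_distr) (auto simp: vimage_def add.commute)
  finally show ?thesis by simp
qed

lemma distr_vertical_shear:
  "distr (lborel \<Otimes>\<^sub>M lborel) (lborel \<Otimes>\<^sub>M lborel) (\<lambda>(x, y). (x, y + c * x))
    = (lborel \<Otimes>\<^sub>M lborel :: (real \<times> real) measure)" (is "distr ?M _ ?T = _")
proof (rule measure_eqI)
  have T: "?T \<in> measurable ?M ?M" by measurable
  fix X assume "X \<in> sets (distr ?M ?M ?T)"
  then have X: "X \<in> sets ?M" by simp
  have "emeasure (distr ?M ?M ?T) X = emeasure ?M (?T -` X \<inter> space ?M)"
    by (rule emeasure_distr[OF T X])
  also have "\<dots> = (\<integral>\<^sup>+x. emeasure lborel (Pair x -` (?T -` X \<inter> space ?M)) \<partial>lborel)"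
    by (rule lborel.emeasure_pair_measure_alt[OF measurable_sets[OF T X]])
  also have "\<dots> = (\<integral>\<^sup>+x. emeasure lborel ((\<lambda>y. y + c * x) -` (Pair x -` X)) \<partial>lborel)"
    by (intro nn_integral_cong arg_cong[where f="emeasure lborel"])
       (auto simp: space_pair_measure)
  also have "\<dots> = (\<integral>\<^sup>+x. emeasure lborel (Pair x -` X) \<partial>lborel)"
    by (intro nn_integral_cong emeasure_lborel_translate sets_Pair1[OF X, unfolded sets_lborel])
  also have "\<dots> = emeasure ?M X"
    by (rule lborel.emeasure_pair_measure_alt[OF X, symmetric])
  finally show "emeasure (distr ?M ?M ?T) X = emeasure ?M X" .
qed simp

lemma distr_horizontal_shear:
  "distr (lborel \<Otimes>\<^sub>M lborel) (lborel \<Otimes>\<^sub>M lborel) (\<lambda>(x, y). (x + c * y, y))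
    = (lborel \<Otimes>\<^sub>M lborel :: (real \<times> real) measure)" (is "distr ?M _ ?T = _")
proof (rule measure_eqI)
  have T: "?T \<in> measurable ?M ?M" by measurable
  fix X assume "X \<in> sets (distr ?M ?M ?T)"
  then have X: "X \<in> sets ?M" by simp
  have "emeasure (distr ?M ?M ?T) X = emeasure ?M (?T -` X \<inter> space ?M)"
    by (rule emeasure_distr[OF T X])
  also have "\<dots> = (\<integral>\<^sup>+y. emeasure lborel ((\<lambda>x. (x, y)) -` (?T -` X \<inter> space ?M)) \<partial>lborel)"
    by (rule lborel_pair.emeasure_pair_measure_alt2[OF measurable_sets[OF T X]])
  also have "\<dots> = (\<integral>\<^sup>+y. emeasure lborel ((\<lambda>x. x + c * y) -` ((\<lambda>x. (x, y)) -` X)) \<partial>lborel)"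
    by (intro nn_integral_cong arg_cong[where f="emeasure lborel"])
       (auto simp: space_pair_measure)
  also have "\<dots> = (\<integral>\<^sup>+y. emeasure lborel ((\<lambda>x. (x, y)) -` X) \<partial>lborel)"
    by (intro nn_integral_cong emeasure_lborel_translate sets_Pair2[OF X, unfolded sets_lborel])
  also have "\<dots> = emeasure ?M X"
    by (rule lborel_pair.emeasure_pair_measure_alt2[OF X, symmetric])
  finally show "emeasure (distr ?M ?M ?T) X = emeasure ?M X" .
qed simp

text \<open>
  A rotation \<open>u = p + i q\<close> by an angle \<open>\<theta>\<close> is a product of three shears: the outer two are horizontal
  with slope \<open>- tan (\<theta> / 2) = - q / (1 + p)\<close>, the middle one is vertical with slope \<open>q = sin \<theta>\<close>.
  Fubini and translation invariance show that each shear preserves area. The half turn has no such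
  factorisation and is treated below as the square of a quarter turn.
\<close>

lemma distr_lborel_rotation_aux:
  assumes u: "cmod u = 1" "u \<noteq> -1"
  shows "distr lborel borel (\<lambda>z. u * z) = (lborel :: complex measure)"
proof -
  define p q where "p = Re u" and "q = Im u"
  have pq: "p\<^sup>2 + q\<^sup>2 = 1"
    using u by (simp add: cmod_def p_def q_def)
  have "p \<noteq> -1"
  proof
    assume "p = -1"
    with pq have "q = 0" by simp
    with \<open>p = -1\<close> u show False by (simp add: p_def q_def complex_eq_iff)
  qed
  then have p1: "1 + p \<noteq> 0" by linarith
  define t where "t = - q / (1 + p)"
  let ?M = "lborel \<Otimes>\<^sub>M lborel :: (real \<times> real) measure"
  let ?H = "\<lambda>(x, y). (x + t * y, y)" and ?V = "\<lambda>(x, y). (x, y + q * x)"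
    and ?C = "\<lambda>(x, y). Complex x y"
  have C: "?C \<in> borel_measurable ?M"
    unfolding lborel_prod measurable_lborel2 case_prod_beta
    by (intro borel_measurable_continuous_onI continuous_intros)
  have H: "?H \<in> measurable ?M ?M" by measurable
  have V: "?V \<in> measurable ?M ?M" by measurable
  have rot: "u * Complex x y = ?C (?H (?V (?H (x, y))))" for x y
  proof -
    have e1: "1 + q * t = p"
    proof -
      have "(1 + p) * (1 + q * t) = (1 + p) * p"
      proof -
        have "(1 + p) * (q * t) = - (q\<^sup>2)"
          using p1 by (simp add: t_def power2_eq_square)
        then show ?thesis using pq by algebra
      qed
      then show ?thesis using p1 by simp
    qed
    have e2: "t + t * p = - q"
    proof -
      have "t * (1 + p) = - q" using p1 by (simp add: t_def)
      then show ?thesis by (simp add: algebra_simps)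
    qed
    have r1: "p * x - q * y = x + t * y + t * (y + q * (x + t * y))"
    proof -
      have "x + t * y + t * (y + q * (x + t * y)) = (1 + q * t) * x + (t + t * (1 + q * t)) * y"
        by algebra
      then show ?thesis using e1 e2 by simp
    qed
    have r2: "p * y + q * x = y + q * (x + t * y)"
    proof -
      have "y + q * (x + t * y) = (1 + q * t) * y + q * x" by algebra
      then show ?thesis using e1 by simp
    qed
    show ?thesis
      using r1 r2 by (simp add: complex_eq_iff p_def q_def)
  qed
  have absorb: "distr ?M borel (g \<circ> f) = distr ?M borel g"
    if "g \<in> borel_measurable ?M" "f \<in> measurable ?M ?M" "distr ?M ?M f = ?M" for g :: "_ \<Rightarrow> complex" and f
    using distr_distr[OF that(1,2)] that(3) by simp
  have CH: "?C \<circ> ?H \<in> borel_measurable ?M" and CHV: "?C \<circ> ?H \<circ> ?V \<in> borel_measurable ?M"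
    using measurable_comp[OF H C] measurable_comp[OF V measurable_comp[OF H C]] by auto
  have "distr lborel borel (\<lambda>z. u * z) = distr (distr ?M borel ?C) borel (\<lambda>z. u * z)"
    by (simp flip: complex_lborel_eq_distr)
  also have "\<dots> = distr ?M borel ((\<lambda>z. u * z) \<circ> ?C)"
    by (rule distr_distr[OF _ C]) (intro borel_measurable_continuous_onI continuous_intros)
  also have "(\<lambda>z. u * z) \<circ> ?C = ?C \<circ> ?H \<circ> ?V \<circ> ?H"
    using rot by (intro ext) (simp add: split_paired_all)
  also have "distr ?M borel (?C \<circ> ?H \<circ> ?V \<circ> ?H) = distr ?M borel ?C"
    using absorb[OF CHV H distr_horizontal_shear] absorb[OF CH V distr_vertical_shear]
      absorb[OF C H distr_horizontal_shear] by simp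
  also have "\<dots> = lborel"
    by (rule complex_lborel_eq_distr[symmetric])
  finally show ?thesis .
qed

lemma distr_lborel_rotation:
  assumes u: "cmod u = 1"
  shows "distr lborel borel (\<lambda>z. u * z) = (lborel :: complex measure)"
proof (cases "u = -1")
  case True
  have "distr lborel borel (\<lambda>z. u * z) = distr (distr lborel borel (\<lambda>z. \<i> * z)) borel (\<lambda>z. \<i> * z)"
    by (subst distr_distr) (auto simp: comp_def True mult.assoc[symmetric] intro!: distr_cong)
  then show ?thesis
    by (simp add: distr_lborel_rotation_aux complex_eq_iff)
qed (use u distr_lborel_rotation_aux in blast)

section \<open>Gaussian integrals over the plane\<close>

lemma has_bochner_integral_gaussian_real:
  assumes "\<delta> > 0"
  shows "has_bochner_integral lborel (\<lambda>x::real. exp (- (\<delta> * x\<^sup>2))) (sqrt (pi / \<delta>))"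
proof -
  define \<sigma> where "\<sigma> = sqrt (1 / (2 * \<delta>))"
  have s: "\<sigma>\<^sup>2 = 1 / (2 * \<delta>)" "\<sigma> > 0" using assms by (auto simp: \<sigma>_def)
  have "has_bochner_integral lborel (\<lambda>x. sqrt (pi / \<delta>) * normal_density 0 \<sigma> x) (sqrt (pi / \<delta>) * 1)"
    using s by (intro has_bochner_integral_mult_right) (simp add: has_bochner_integral_iff)
  moreover have "sqrt (pi / \<delta>) * normal_density 0 \<sigma> x = exp (- (\<delta> * x\<^sup>2))" for x
    using assms s by (simp add: normal_density_def)
  ultimately show ?thesis by simp
qed

lemma gaussian_complex:
  assumes d: "\<delta> > 0"
  shows integrable_gaussian: "integrable lborel (\<lambda>z. exp (- (\<delta> * (cmod z)\<^sup>2)))"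
    and integral_gaussian: "(LINT z|lborel. exp (- (\<delta> * (cmod z)\<^sup>2))) = pi / \<delta>"
proof -
  have m: "(\<lambda>(x, y). Complex x y) \<in> borel_measurable (lborel \<Otimes>\<^sub>M lborel)"
    unfolding lborel_prod measurable_lborel2 case_prod_beta
    by (intro borel_measurable_continuous_onI continuous_intros)
  have nn: "(\<integral>\<^sup>+x. ennreal (exp (- (\<delta> * x\<^sup>2))) \<partial>lborel) = ennreal (sqrt (pi / \<delta>))"
    using has_bochner_integral_gaussian_real[OF d]
    by (subst nn_integral_eq_integral) (auto simp: has_bochner_integral_iff)
  have "(\<integral>\<^sup>+z. ennreal (exp (- (\<delta> * (cmod z)\<^sup>2))) \<partial>lborel)
      = (\<integral>\<^sup>+(x, y). ennreal (exp (- (\<delta> * (cmod (Complex x y))\<^sup>2))) \<partial>(lborel \<Otimes>\<^sub>M lborel))"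
    by (subst complex_lborel_eq_distr, subst nn_integral_distr[OF m]) (auto simp: case_prod_beta')
  also have "\<dots> = (\<integral>\<^sup>+x. \<integral>\<^sup>+y. ennreal (exp (- (\<delta> * (cmod (Complex x y))\<^sup>2))) \<partial>lborel \<partial>lborel)"
  proof -
    have "(\<lambda>z. ennreal (exp (- (\<delta> * (cmod z)\<^sup>2)))) \<in> borel_measurable borel"
      by measurable
    from measurable_compose[OF m this]
    have [measurable]: "(\<lambda>(x, y). ennreal (exp (- (\<delta> * (cmod (Complex x y))\<^sup>2))))
        \<in> borel_measurable (lborel \<Otimes>\<^sub>M lborel)"
      by (simp add: case_prod_beta')
    show ?thesis
      by (subst lborel.nn_integral_fst[symmetric]) (auto simp: split_beta)
  qed
  also have "\<dots> = (\<integral>\<^sup>+x. \<integral>\<^sup>+y. ennreal (exp (- (\<delta> * x\<^sup>2))) * ennreal (exp (- (\<delta> * y\<^sup>2))) \<partial>lborel \<partial>lborel)"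
    by (simp add: cmod_def ring_distribs exp_add[symmetric] flip: ennreal_mult')
  also have "\<dots> = ennreal (sqrt (pi / \<delta>)) * ennreal (sqrt (pi / \<delta>))"
    by (simp add: nn_integral_cmult nn_integral_multc nn)
  also have "\<dots> = ennreal (pi / \<delta>)"
    using d by (simp flip: ennreal_mult')
  finally have *: "(\<integral>\<^sup>+z. ennreal (exp (- (\<delta> * (cmod z)\<^sup>2))) \<partial>lborel) = ennreal (pi / \<delta>)" .
  show "integrable lborel (\<lambda>z. exp (- (\<delta> * (cmod z)\<^sup>2)))"
    by (rule integrableI_nonneg) (auto simp: *)
  show "(LINT z|lborel. exp (- (\<delta> * (cmod z)\<^sup>2))) = pi / \<delta>"
    using d * by (subst integral_eq_nn_integral) auto
qed

lemma
  fixes g :: "complex \<Rightarrow> 'b::{banach, second_countable_topology}"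
  assumes g: "g \<in> borel_measurable borel" and u: "cmod u = 1"
  shows integrable_lborel_rotate: "integrable lborel (\<lambda>z. g (u * z)) \<longleftrightarrow> integrable lborel g"
    and integral_lborel_rotate: "(LINT z|lborel. g (u * z)) = (LINT z|lborel. g z)"
proof -
  have m: "(\<lambda>z. u * z) \<in> measurable lborel borel" by simp
  show "integrable lborel (\<lambda>z. g (u * z)) \<longleftrightarrow> integrable lborel g"
    using integrable_distr_eq[OF m g] by (simp add: distr_lborel_rotation[OF u])
  show "(LINT z|lborel. g (u * z)) = (LINT z|lborel. g z)"
    using integral_distr[OF m g] by (simp add: distr_lborel_rotation[OF u])
qed

lemma
  fixes g :: "'a::euclidean_space \<Rightarrow> 'b::{banach, second_countable_topology}"
  assumes g: "g \<in> borel_measurable borel"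
  shows integrable_lborel_shift: "integrable lborel (\<lambda>z. g (w + z)) \<longleftrightarrow> integrable lborel g"
    and integral_lborel_shift: "(LINT z|lborel. g (w + z)) = (LINT z|lborel. g z)"
proof -
  have m: "(\<lambda>z. w + z) \<in> measurable lborel borel" by simp
  show "integrable lborel (\<lambda>z. g (w + z)) \<longleftrightarrow> integrable lborel g"
    using integrable_distr_eq[OF m g] by (simp add: lborel_distr_plus)
  show "(LINT z|lborel. g (w + z)) = (LINT z|lborel. g z)"
    using integral_distr[OF m g] by (simp add: lborel_distr_plus)
qed

lemma entire_borel_measurable:
  "f holomorphic_on UNIV \<Longrightarrow> f \<in> borel_measurable (borel :: complex measure)"
  by (intro borel_measurable_continuous_onI holomorphic_on_imp_continuous_on)

lemma entire_affine:
  assumes "f holomorphic_on UNIV"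
  shows "(\<lambda>z. f (\<alpha> * z + \<beta>)) holomorphic_on S"
proof -
  have "f \<circ> (\<lambda>z. \<alpha> * z + \<beta>) holomorphic_on S"
    by (rule holomorphic_on_compose_gen[OF _ assms]) (auto intro!: holomorphic_intros)
  then show ?thesis by (simp add: comp_def)
qed

lemma borel_measurable_cnj[measurable]: "cnj \<in> borel_measurable borel"
  by (intro borel_measurable_continuous_onI continuous_intros)

section \<open>The reproducing property\<close>

lemma circle_mean_value:
  assumes F: "F holomorphic_on UNIV"
  shows "((\<lambda>t. F (cis (2 * pi * t) * z)) has_integral F 0) {0..1}"
proof -
  have "(\<lambda>u. F (u * z)) holomorphic_on cball 0 1"
    using entire_affine[OF F, of z 0] by (simp add: mult.commute)
  then have "((\<lambda>u. F (u * z) / (u - 0)) has_contour_integral (2 * of_real pi * \<i> * F (0 * z))) (circlepath 0 1)"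
    by (intro Cauchy_integral_circlepath_simple) auto
  then have "((\<lambda>x. F (circlepath 0 1 x * z) / circlepath 0 1 x *
       vector_derivative (circlepath 0 1) (at x)) has_integral (2 * of_real pi * \<i> * F 0)) {0..1}"
    by (simp add: has_contour_integral)
  moreover have "F (circlepath 0 1 x * z) / circlepath 0 1 x *
       vector_derivative (circlepath 0 1) (at x) = 2 * of_real pi * \<i> * F (cis (2 * pi * x) * z)" for x
    by (simp add: vector_derivative_circlepath) (simp add: circlepath_def part_circlepath_def linepath_def cis_conv_exp mult_ac)
  ultimately have "((\<lambda>x. 2 * of_real pi * \<i> * F (cis (2 * pi * x) * z)) has_integral (2 * of_real pi * \<i> * F 0)) {0..1}"
    by simp
  from has_integral_mult_right[OF this, of "1 / (2 * of_real pi * \<i>)"] show ?thesis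
    by simp
qed

text \<open>
  Rotation invariance allows \<open>F z\<close> to be replaced by its average over the circle through \<open>z\<close>, which is
  \<open>F 0\<close> by Cauchy. Only integrability of \<open>F\<close> against the Gaussian is assumed, so no growth bound on
  elements of the Fock space has to be known beforehand.
\<close>

lemma gaussian_mean_value:
  assumes F: "F holomorphic_on UNIV"
    and int: "integrable lborel (\<lambda>z. F z * of_real (exp (- (cmod z)\<^sup>2)))"
  shows "(LINT z|lborel. F z * of_real (exp (- (cmod z)\<^sup>2))) = of_real pi * F 0"
proof -
  define G where "G z = F z * of_real (exp (- (cmod z)\<^sup>2))" for z
  define H where "H t z = indicator {0..1::real} t *\<^sub>R G (cis (2 * pi * t) * z)" for t z
  have [measurable]: "F \<in> borel_measurable borel"
    by (rule entire_borel_measurable[OF F])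
  have G[measurable]: "G \<in> borel_measurable borel"
    unfolding G_def by measurable
  have rot: "G (cis s * z) = F (cis s * z) * of_real (exp (- (cmod z)\<^sup>2))" for s z
    by (simp add: G_def norm_mult)
  have [measurable]: "cis \<in> borel_measurable borel"
    by (intro borel_measurable_continuous_onI continuous_intros)
  have meas: "case_prod H \<in> borel_measurable (lborel \<Otimes>\<^sub>M lborel)"
    unfolding H_def by measurable
  have intG: "integrable lborel (\<lambda>z. G (cis s * z))" for s
  proof -
    have "integrable lborel G" using int by (simp add: G_def[abs_def])
    then show ?thesis using integrable_lborel_rotate[OF G, of "cis s"] by simp
  qed
  have intH: "integrable (lborel \<Otimes>\<^sub>M lborel) (case_prod H)"
  proof (rule lborel_pair.Fubini_integrable[OF meas])
    have "(LINT z|lborel. norm (H t z)) = indicator {0..1} t * (LINT z|lborel. norm (G z))" for t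
      using integral_lborel_rotate[of "\<lambda>z. norm (G z)" "cis (2 * pi * t)"]
      by (simp add: H_def)
    then show "integrable lborel (\<lambda>t. LINT z|lborel. norm (case_prod H (t, z)))"
      by simp
  qed (simp add: H_def intG)
  have "(LINT z|lborel. LINT t|lborel. H t z) = (LINT t|lborel. LINT z|lborel. H t z)"
    by (rule lborel_pair.Fubini_integral[OF intH])
  moreover have "(LINT z|lborel. H t z) = indicator {0..1} t *\<^sub>R (LINT z|lborel. G z)" for t
    using integral_lborel_rotate[OF G, of "cis (2 * pi * t)"] by (simp add: H_def)
  moreover have "(LINT t|lborel. H t z) = F 0 * of_real (exp (- (cmod z)\<^sup>2))" for z
  proof -
    have "continuous_on {0..1::real} (\<lambda>t. G (cis (2 * pi * t) * z))"
      unfolding rot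
      by (intro continuous_intros continuous_on_compose2[OF holomorphic_on_imp_continuous_on[OF F]]) auto
    then have si: "set_integrable lborel {0..1} (\<lambda>t. G (cis (2 * pi * t) * z))"
      by (rule borel_integrable_atLeastAtMost')
    have "((\<lambda>t. G (cis (2 * pi * t) * z)) has_integral (F 0 * of_real (exp (- (cmod z)\<^sup>2)))) {0..1}"
      unfolding rot by (intro has_integral_mult_left circle_mean_value[OF F])
    then show ?thesis
      using set_borel_integral_eq_integral(2)[OF si]
      by (simp add: set_lebesgue_integral_def H_def integral_unique)
  qed
  ultimately have "(LINT z|lborel. F 0 * of_real (exp (- (cmod z)\<^sup>2))) = (LINT z|lborel. G z)"
    by simp
  moreover have "(LINT z|lborel. F 0 * of_real (exp (- (cmod z)\<^sup>2))) = of_real pi * F 0"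
    using integral_gaussian[of 1] by simp
  ultimately show ?thesis by (simp add: G_def)
qed

text \<open>
  Square integrability without holomorphy. It is kept separate from \<^const>\<open>fock_space\<close> because the
  dominating functions used below are not entire.
\<close>

definition gaussian_L2 :: "(complex \<Rightarrow> complex) set" where
  "gaussian_L2 = {F. F \<in> borel_measurable borel \<and>
     integrable lborel (\<lambda>z. (cmod (F z))\<^sup>2 * exp (- (cmod z)\<^sup>2))}"

lemma fock_space_iff: "f \<in> fock_space \<longleftrightarrow> f holomorphic_on UNIV \<and> f \<in> gaussian_L2"
  by (auto simp: fock_space_def gaussian_L2_def entire_borel_measurable)

lemma fock_space_L2: "f \<in> fock_space \<Longrightarrow> f \<in> gaussian_L2"
  and fock_space_entire: "f \<in> fock_space \<Longrightarrow> f holomorphic_on UNIV"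
  by (auto simp: fock_space_iff)

lemma two_mult_le_sum_squares: "2 * (x * y) \<le> x\<^sup>2 + (y::real)\<^sup>2"
  using sum_squares_bound[of x y] by simp

lemma exp_square_mult: "(exp y)\<^sup>2 * exp (- x) = exp (2 * y - (x::real))"
  by (simp add: exp_double exp_diff exp_minus divide_inverse)

lemma gaussian_L2_integrable:
  assumes "F \<in> gaussian_L2" "G \<in> gaussian_L2"
  shows integrable_norm_pairing: "integrable lborel (\<lambda>z. cmod (F z) * cmod (G z) * exp (- (cmod z)\<^sup>2))"
    and integrable_pairing: "integrable lborel (\<lambda>z. F z * cnj (G z) * of_real (exp (- (cmod z)\<^sup>2)))"
proof -
  have [measurable]: "F \<in> borel_measurable borel" "G \<in> borel_measurable borel"
    using assms by (auto simp: gaussian_L2_def)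
  show *: "integrable lborel (\<lambda>z. cmod (F z) * cmod (G z) * exp (- (cmod z)\<^sup>2))"
  proof (rule Bochner_Integration.integrable_bound)
    show "integrable lborel (\<lambda>z. (cmod (F z))\<^sup>2 * exp (- (cmod z)\<^sup>2) + (cmod (G z))\<^sup>2 * exp (- (cmod z)\<^sup>2))"
      using assms by (auto simp: gaussian_L2_def)
    have "cmod (F z) * cmod (G z) \<le> (cmod (F z))\<^sup>2 + (cmod (G z))\<^sup>2" for z
    proof -
      have "0 \<le> cmod (F z) * cmod (G z)" by simp
      with two_mult_le_sum_squares[of "cmod (F z)" "cmod (G z)"] show ?thesis by linarith
    qed
    then show "AE z in lborel. norm (cmod (F z) * cmod (G z) * exp (- (cmod z)\<^sup>2))
        \<le> norm ((cmod (F z))\<^sup>2 * exp (- (cmod z)\<^sup>2) + (cmod (G z))\<^sup>2 * exp (- (cmod z)\<^sup>2))"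
      by (intro AE_I2) (simp flip: ring_distribs(2))
  qed measurable
  show "integrable lborel (\<lambda>z. F z * cnj (G z) * of_real (exp (- (cmod z)\<^sup>2)))"
    by (rule Bochner_Integration.integrable_bound[OF *]) (auto simp: norm_mult)
qed

text \<open>
  Any growth strictly below \<open>exp (|z|\<^sup>2 / 2)\<close> is square integrable for the Gaussian weight, whatever
  the linear term in the exponent: completing the square absorbs it into half of the spare quadratic
  decay \<open>1 - s\<close>.
\<close>

lemma gaussian_L2_growth:
  assumes F[measurable]: "F \<in> borel_measurable borel"
    and s: "s < 1" and le: "\<And>z. cmod (F z) \<le> K * exp (\<kappa> * cmod z + s / 2 * (cmod z)\<^sup>2)"
  shows "F \<in> gaussian_L2"
proof -
  define \<delta> where "\<delta> = (1 - s) / 2"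
  have d: "\<delta> > 0" using s by (simp add: \<delta>_def)
  have "integrable lborel (\<lambda>z. (cmod (F z))\<^sup>2 * exp (- (cmod z)\<^sup>2))"
  proof (rule Bochner_Integration.integrable_bound)
    show "integrable lborel (\<lambda>z::complex. K\<^sup>2 * exp (\<kappa>\<^sup>2 / \<delta>) * exp (- (\<delta> * (cmod z)\<^sup>2)))"
      using integrable_gaussian[OF d] by simp
    show "AE z in lborel. norm ((cmod (F z))\<^sup>2 * exp (- (cmod z)\<^sup>2))
        \<le> norm (K\<^sup>2 * exp (\<kappa>\<^sup>2 / \<delta>) * exp (- (\<delta> * (cmod z)\<^sup>2)))"
    proof (rule AE_I2)
      fix z
      have "2 * (\<kappa> * cmod z) \<le> \<kappa>\<^sup>2 / \<delta> + \<delta> * (cmod z)\<^sup>2"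
      proof -
        have "2 * ((\<kappa> / sqrt \<delta>) * (sqrt \<delta> * cmod z)) \<le> (\<kappa> / sqrt \<delta>)\<^sup>2 + (sqrt \<delta> * cmod z)\<^sup>2"
          by (rule two_mult_le_sum_squares)
        then show ?thesis using d by (simp add: power_divide power_mult_distrib)
      qed
      then have e: "2 * (\<kappa> * cmod z + s / 2 * (cmod z)\<^sup>2) - (cmod z)\<^sup>2 \<le> \<kappa>\<^sup>2 / \<delta> - \<delta> * (cmod z)\<^sup>2"
        by (simp add: \<delta>_def field_simps)
      have "(cmod (F z))\<^sup>2 * exp (- (cmod z)\<^sup>2)
          \<le> (K * exp (\<kappa> * cmod z + s / 2 * (cmod z)\<^sup>2))\<^sup>2 * exp (- (cmod z)\<^sup>2)"
        by (intro mult_right_mono power_mono le) auto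
      also have "\<dots> = K\<^sup>2 * exp (2 * (\<kappa> * cmod z + s / 2 * (cmod z)\<^sup>2) - (cmod z)\<^sup>2)"
        by (simp only: power_mult_distrib exp_square_mult mult.assoc)
      also have "\<dots> \<le> K\<^sup>2 * exp (\<kappa>\<^sup>2 / \<delta> - \<delta> * (cmod z)\<^sup>2)"
        using e by (intro mult_left_mono) auto
      finally show "norm ((cmod (F z))\<^sup>2 * exp (- (cmod z)\<^sup>2))
          \<le> norm (K\<^sup>2 * exp (\<kappa>\<^sup>2 / \<delta>) * exp (- (\<delta> * (cmod z)\<^sup>2)))"
        by (simp add: exp_diff exp_minus divide_inverse mult.assoc)
    qed
  qed measurable
  then show ?thesis by (simp add: gaussian_L2_def)
qed

lemma fock_inner_cnj: "cnj (fock_inner f g) = fock_inner g f"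
proof -
  have "cnj (fock_inner f g)
      = of_real (1 / pi) * (LINT z|lborel. cnj (f z * cnj (g z) * of_real (exp (- (cmod z)\<^sup>2))))"
    unfolding fock_inner_def Bochner_Integration.integral_cnj by simp
  then show ?thesis by (simp add: fock_inner_def mult_ac)
qed

lemma fock_inner_scale_left: "fock_inner (\<lambda>z. c * f z) g = c * fock_inner f g"
  by (simp add: fock_inner_def mult_ac)

lemma fock_inner_scale_right: "fock_inner f (\<lambda>z. c * g z) = cnj c * fock_inner f g"
  by (simp add: fock_inner_def mult_ac)

lemma exp_linear_L2: "(\<lambda>z. exp (w * z)) \<in> gaussian_L2"
proof (rule gaussian_L2_growth[where s=0 and \<kappa>="cmod w" and K=1])
  show "cmod (exp (w * z)) \<le> 1 * exp (cmod w * cmod z + 0 / 2 * (cmod z)\<^sup>2)" for z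
    using complex_Re_le_cmod[of "w * z"] by (simp add: norm_mult)
qed (auto intro!: entire_borel_measurable holomorphic_intros)

text \<open>
  Translation by \<open>w\<close> turns the Gaussian weight times the conjugated kernel at \<open>w\<close> into the Gaussian weight times
  a zero-free entire function with value \<open>1\<close> at the origin. This reduces the reproducing property at
  \<open>w\<close> to the mean value property at \<open>0\<close>.
\<close>

lemma gaussian_shift:
  "exp (w * cnj (w + z)) * of_real (exp (- (cmod (w + z))\<^sup>2))
    = exp (- cnj w * z) * complex_of_real (exp (- (cmod z)\<^sup>2))"
proof -
  have "w * cnj (w + z) - of_real ((cmod (w + z))\<^sup>2) = - cnj w * z - of_real ((cmod z)\<^sup>2)"
    unfolding complex_norm_square by (simp add: algebra_simps)
  then show ?thesis
    by (simp flip: exp_of_real exp_add)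
qed

lemma fock_reproducing:
  assumes v: "v \<in> fock_space"
  shows "fock_inner v (\<lambda>z. exp (cnj w * z)) = v w"
proof -
  have hol: "v holomorphic_on UNIV" and L2: "v \<in> gaussian_L2"
    using v by (auto simp: fock_space_iff)
  note [measurable] = entire_borel_measurable[OF hol]
  define g where "g z = v z * exp (w * cnj z) * of_real (exp (- (cmod z)\<^sup>2))" for z
  have [measurable]: "(\<lambda>z. exp (w * cnj z)) \<in> borel_measurable borel"
    by (intro borel_measurable_continuous_onI continuous_intros)
  have gm: "g \<in> borel_measurable borel" unfolding g_def by measurable
  have gi: "integrable lborel g"
    using integrable_pairing[OF L2 exp_linear_L2[of "cnj w"]] by (simp add: g_def[abs_def] exp_cnj)
  have shift: "g (w + z) = (v (w + z) * exp (- cnj w * z)) * of_real (exp (- (cmod z)\<^sup>2))" for z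
    unfolding g_def using gaussian_shift[of w z] by (simp add: mult.assoc)
  have "(LINT z|lborel. g z) = (LINT z|lborel. (v (w + z) * exp (- cnj w * z)) * of_real (exp (- (cmod z)\<^sup>2)))"
    using integral_lborel_shift[OF gm, of w] by (simp only: shift)
  also have "\<dots> = of_real pi * (v (w + 0) * exp (- cnj w * 0))"
  proof (rule gaussian_mean_value)
    have "(\<lambda>z. v (w + z)) holomorphic_on UNIV"
      using entire_affine[OF hol, of 1 w] by (simp add: add.commute)
    then show "(\<lambda>z. v (w + z) * exp (- cnj w * z)) holomorphic_on UNIV"
      by (intro holomorphic_intros)
    show "integrable lborel (\<lambda>z. v (w + z) * exp (- cnj w * z) * of_real (exp (- (cmod z)\<^sup>2)))"
      using gi integrable_lborel_shift[OF gm, of w] by (simp only: shift)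
  qed
  finally show ?thesis
    by (simp add: fock_inner_def g_def exp_cnj)
qed

text \<open>
  This is the Cauchy-Schwarz bound \<open>|v w| \<le> \<parallel>v\<parallel> \<parallel>K\<^sub>w\<parallel>\<close> with \<open>\<parallel>K\<^sub>w\<parallel> = exp (|w|\<^sup>2 / 2)\<close>, up to
  the constant: the arithmetic-geometric mean inequality, weighted with \<open>exp (|w|\<^sup>2 / 2)\<close>, suffices.
\<close>

lemma fock_pointwise_bound:
  assumes v: "v \<in> fock_space"
  obtains K where "K \<ge> 0" "\<And>w. cmod (v w) \<le> K * exp ((cmod w)\<^sup>2 / 2)"
proof
  define N where "N = (LINT z|lborel. (cmod (v z))\<^sup>2 * exp (- (cmod z)\<^sup>2))"
  have L2: "v \<in> gaussian_L2" using v by (rule fock_space_L2)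
  have [measurable]: "v \<in> borel_measurable borel" using L2 by (simp add: gaussian_L2_def)
  show "(N + pi) / (2 * pi) \<ge> 0"
    by (auto simp: N_def intro!: divide_nonneg_pos add_nonneg_nonneg)
  fix w
  define E where "E z = exp (cnj w * z)" for z
  have EL2: "E \<in> gaussian_L2" unfolding E_def by (rule exp_linear_L2)
  define k where "k z = exp (- (cmod (z - w))\<^sup>2)" for z
  have Ek: "(cmod (E z))\<^sup>2 * exp (- (cmod z)\<^sup>2) = exp ((cmod w)\<^sup>2) * k z" for z
  proof -
    have "2 * Re (cnj w * z) - (cmod z)\<^sup>2 = (cmod w)\<^sup>2 - (cmod (z - w))\<^sup>2"
      unfolding cmod_power2 by (simp add: algebra_simps power2_eq_square)
    then show ?thesis
      by (simp add: E_def k_def flip: exp_add exp_double)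
  qed
  have km: "k \<in> borel_measurable borel" unfolding k_def by measurable
  have ki: "integrable lborel k" "(LINT z|lborel. k z) = pi"
    using integrable_gaussian[of 1] integral_gaussian[of 1]
      integrable_lborel_shift[OF km, of w] integral_lborel_shift[OF km, of w]
    by (simp_all add: k_def)
  define e where "e = exp ((cmod w)\<^sup>2 / 2)"
  have e: "e > 0" "exp ((cmod w)\<^sup>2) = e * e" by (auto simp: e_def simp flip: exp_add)
  have "pi * cmod (v w) = cmod (LINT z|lborel. v z * cnj (E z) * of_real (exp (- (cmod z)\<^sup>2)))"
    using fock_reproducing[OF v, of w] by (auto simp: fock_inner_def E_def norm_mult norm_divide field_simps)
  also have "\<dots> \<le> (LINT z|lborel. cmod (v z) * cmod (E z) * exp (- (cmod z)\<^sup>2))"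
    by (rule order_trans[OF integral_norm_bound]) (simp add: norm_mult)
  also have "\<dots> \<le> (LINT z|lborel. (e * ((cmod (v z))\<^sup>2 * exp (- (cmod z)\<^sup>2)) + e * k z) / 2)"
  proof (rule integral_mono)
    fix z
    have "2 * (e * cmod (v z) * cmod (E z)) \<le> (e * cmod (v z))\<^sup>2 + (cmod (E z))\<^sup>2"
      by (rule two_mult_le_sum_squares)
    then have "e * (2 * (cmod (v z) * cmod (E z))) * exp (- (cmod z)\<^sup>2)
        \<le> ((e * cmod (v z))\<^sup>2 + (cmod (E z))\<^sup>2) * exp (- (cmod z)\<^sup>2)"
      by (intro mult_right_mono) (auto simp: mult_ac)
    also have "\<dots> = e * (e * ((cmod (v z))\<^sup>2 * exp (- (cmod z)\<^sup>2)) + e * k z)"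
      using Ek[of z] e(2) by (simp add: algebra_simps power2_eq_square)
    finally have "e * (2 * (cmod (v z) * cmod (E z) * exp (- (cmod z)\<^sup>2)))
        \<le> e * (e * ((cmod (v z))\<^sup>2 * exp (- (cmod z)\<^sup>2)) + e * k z)"
      by (simp add: mult_ac)
    then show "cmod (v z) * cmod (E z) * exp (- (cmod z)\<^sup>2)
        \<le> (e * ((cmod (v z))\<^sup>2 * exp (- (cmod z)\<^sup>2)) + e * k z) / 2"
      using e(1) by simp
  next
    show "integrable lborel (\<lambda>z. cmod (v z) * cmod (E z) * exp (- (cmod z)\<^sup>2))"
      by (rule integrable_norm_pairing[OF L2 EL2])
    show "integrable lborel (\<lambda>z. (e * ((cmod (v z))\<^sup>2 * exp (- (cmod z)\<^sup>2)) + e * k z) / 2)"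
      using L2 ki by (auto simp: gaussian_L2_def)
  qed
  also have "\<dots> = (N + pi) / 2 * e"
    using L2 ki by (simp add: gaussian_L2_def N_def algebra_simps)
  finally show "cmod (v w) \<le> (N + pi) / (2 * pi) * exp ((cmod w)\<^sup>2 / 2)"
    by (simp add: e_def field_simps)
qed

section \<open>Functions of exponential type and expansions of the inner product\<close>

definition exponential_type :: "(complex \<Rightarrow> complex) \<Rightarrow> bool" where
  "exponential_type F \<longleftrightarrow> F holomorphic_on UNIV \<and> (\<exists>K \<kappa>. \<forall>z. cmod (F z) \<le> K * exp (\<kappa> * cmod z))"

lemma exponential_typeI:
  "F holomorphic_on UNIV \<Longrightarrow> (\<And>z. cmod (F z) \<le> K * exp (\<kappa> * cmod z)) \<Longrightarrow> exponential_type F"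
  unfolding exponential_type_def by blast

lemma exponential_type_const: "exponential_type (\<lambda>z. c)"
  by (rule exponential_typeI[where K="cmod c" and \<kappa>=0]) auto

lemma exponential_type_affine: "exponential_type (\<lambda>z. \<alpha> * z + \<beta>)"
proof (rule exponential_typeI[where K="cmod \<alpha> + cmod \<beta>" and \<kappa>=1])
  fix z
  have "cmod z \<le> exp (cmod z)" "1 \<le> exp (cmod z)"
    using exp_ge_add_one_self[of "cmod z"] norm_ge_zero[of z] by linarith+
  then have "cmod \<alpha> * cmod z + cmod \<beta> * 1 \<le> cmod \<alpha> * exp (cmod z) + cmod \<beta> * exp (cmod z)"
    by (intro add_mono mult_left_mono) auto
  moreover have "cmod (\<alpha> * z + \<beta>) \<le> cmod \<alpha> * cmod z + cmod \<beta>"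
    by (rule norm_triangle_le) (simp add: norm_mult)
  ultimately show "cmod (\<alpha> * z + \<beta>) \<le> (cmod \<alpha> + cmod \<beta>) * exp (1 * cmod z)"
    by (simp add: algebra_simps)
qed (intro holomorphic_intros)

lemma exponential_type_exp: "exponential_type (\<lambda>z. exp (\<alpha> * z + \<beta>))"
proof (rule exponential_typeI[where K="exp (cmod \<beta>)" and \<kappa>="cmod \<alpha>"])
  fix z
  have "Re (\<alpha> * z + \<beta>) \<le> cmod \<beta> + cmod \<alpha> * cmod z"
    using complex_Re_le_cmod[of "\<alpha> * z + \<beta>"] norm_triangle_ineq[of "\<alpha> * z" \<beta>]
    by (simp add: norm_mult)
  then show "cmod (exp (\<alpha> * z + \<beta>)) \<le> exp (cmod \<beta>) * exp (cmod \<alpha> * cmod z)"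
    by (simp flip: exp_add)
qed (intro holomorphic_intros)

lemma exponential_type_mult:
  assumes "exponential_type F" "exponential_type G"
  shows "exponential_type (\<lambda>z. F z * G z)"
proof -
  obtain K \<kappa> L \<mu> where K: "\<And>z. cmod (F z) \<le> K * exp (\<kappa> * cmod z)"
    and L: "\<And>z. cmod (G z) \<le> L * exp (\<mu> * cmod z)"
    using assms unfolding exponential_type_def by blast
  have "cmod (F z * G z) \<le> (K * L) * exp ((\<kappa> + \<mu>) * cmod z)" for z
  proof -
    have "cmod (F z) * cmod (G z) \<le> (K * exp (\<kappa> * cmod z)) * (L * exp (\<mu> * cmod z))"
      by (intro mult_mono K L order_trans[OF norm_ge_zero K]) auto
    then show ?thesis by (simp add: norm_mult exp_add ring_distribs mult_ac)
  qed
  then show ?thesis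
    using assms by (intro exponential_typeI) (auto simp: exponential_type_def intro!: holomorphic_intros)
qed

lemma exponential_type_power:
  "exponential_type F \<Longrightarrow> exponential_type (\<lambda>z. F z ^ n)"
  by (induction n) (auto intro: exponential_type_const exponential_type_mult)

lemmas exponential_type_intros =
  exponential_type_const exponential_type_affine exponential_type_exp
  exponential_type_mult exponential_type_power

lemma exponential_type_linear:
  "exponential_type (\<lambda>z. z)" "exponential_type (\<lambda>z. exp (\<alpha> * z))"
  using exponential_type_affine[of 1 0] exponential_type_exp[of \<alpha> 0]
  by simp_all

lemma exponential_type_imp_fock: "exponential_type F \<Longrightarrow> F \<in> fock_space"
  unfolding exponential_type_def fock_space_iff
  using gaussian_L2_growth[where s=0 and F=F] by (auto intro: entire_borel_measurable)

lemma gaussian_L2_bound: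
  assumes F[measurable]: "F \<in> borel_measurable borel" and W: "W \<in> gaussian_L2"
    and le: "\<And>z. cmod (F z) \<le> cmod (W z)"
  shows "F \<in> gaussian_L2"
proof -
  have "integrable lborel (\<lambda>z. (cmod (F z))\<^sup>2 * exp (- (cmod z)\<^sup>2))"
  proof (rule Bochner_Integration.integrable_bound)
    show "integrable lborel (\<lambda>z. (cmod (W z))\<^sup>2 * exp (- (cmod z)\<^sup>2))"
      using W by (simp add: gaussian_L2_def)
    show "AE z in lborel. norm ((cmod (F z))\<^sup>2 * exp (- (cmod z)\<^sup>2))
        \<le> norm ((cmod (W z))\<^sup>2 * exp (- (cmod z)\<^sup>2))"
      using le by (intro AE_I2) (simp add: power_mono)
  qed measurable
  then show ?thesis by (simp add: gaussian_L2_def)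
qed

lemma fock_inner_sum_right:
  assumes "v \<in> gaussian_L2" "\<And>n. n \<in> I \<Longrightarrow> F n \<in> gaussian_L2"
  shows "fock_inner v (\<lambda>z. \<Sum>n\<in>I. F n z) = (\<Sum>n\<in>I. fock_inner v (F n))"
proof -
  have "(LINT z|lborel. v z * cnj (\<Sum>n\<in>I. F n z) * of_real (exp (- (cmod z)\<^sup>2)))
      = (\<Sum>n\<in>I. LINT z|lborel. v z * cnj (F n z) * of_real (exp (- (cmod z)\<^sup>2)))"
    using integrable_pairing[OF assms]
    by (subst Bochner_Integration.integral_sum[symmetric])
       (auto simp: sum_distrib_left sum_distrib_right)
  then show ?thesis by (simp add: fock_inner_def sum_distrib_left)
qed

text \<open>
  A pointwise convergent series may be paired with \<open>v\<close> term by term as soon as all partial sums of the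
  absolute values stay below one square integrable function. Both power series expansions used in the
  proof of the main theorem are instances.
\<close>

lemma fock_inner_sums_right:
  assumes v: "v \<in> gaussian_L2" and W: "W \<in> gaussian_L2"
    and F[measurable]: "\<And>n. F n \<in> borel_measurable borel"
    and sums: "\<And>z. (\<lambda>n. F n z) sums S z"
    and bound: "\<And>N z. (\<Sum>n<N. cmod (F n z)) \<le> cmod (W z)"
  shows "(\<lambda>n. fock_inner v (F n)) sums fock_inner v S"
proof -
  have [measurable]: "v \<in> borel_measurable borel" using v by (simp add: gaussian_L2_def)
  have [measurable]: "S \<in> borel_measurable borel"
    by (rule borel_measurable_LIMSEQ_metric[where f="\<lambda>N z. \<Sum>n<N. F n z"])
       (use sums in \<open>auto simp: sums_def\<close>)
  have "cmod (F n z) \<le> cmod (W z)" for n z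
    using bound[of z "Suc n"] sum_nonneg[of "{..<n}" "\<lambda>k. cmod (F k z)"] by simp
  then have L2: "F n \<in> gaussian_L2" for n
    by (rule gaussian_L2_bound[OF F W])
  have "(\<lambda>N. LINT z|lborel. v z * cnj (\<Sum>n<N. F n z) * of_real (exp (- (cmod z)\<^sup>2)))
      \<longlonglongrightarrow> (LINT z|lborel. v z * cnj (S z) * of_real (exp (- (cmod z)\<^sup>2)))"
  proof (rule integral_dominated_convergence)
    show "integrable lborel (\<lambda>z. cmod (v z) * cmod (W z) * exp (- (cmod z)\<^sup>2))"
      by (rule integrable_norm_pairing[OF v W])
    show "AE z in lborel. (\<lambda>N. v z * cnj (\<Sum>n<N. F n z) * of_real (exp (- (cmod z)\<^sup>2)))
        \<longlonglongrightarrow> v z * cnj (S z) * of_real (exp (- (cmod z)\<^sup>2))"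
      using sums by (intro AE_I2 tendsto_intros) (simp add: sums_def)
    show "AE z in lborel. norm (v z * cnj (\<Sum>n<N. F n z) * of_real (exp (- (cmod z)\<^sup>2)))
        \<le> cmod (v z) * cmod (W z) * exp (- (cmod z)\<^sup>2)" for N
      using order_trans[OF norm_sum bound]
      by (intro AE_I2) (auto simp: norm_mult simp del: cnj_sum intro!: mult_mono)
  qed measurable
  then have "(\<lambda>N. fock_inner v (\<lambda>z. \<Sum>n<N. F n z)) \<longlonglongrightarrow> fock_inner v S"
    unfolding fock_inner_def by (intro tendsto_intros)
  moreover have "fock_inner v (\<lambda>z. \<Sum>n<N. F n z) = (\<Sum>n<N. fock_inner v (F n))" for N
    by (rule fock_inner_sum_right[OF v L2])
  ultimately show ?thesis
    by (simp add: sums_def)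
qed

lemma sum_exp_series_le: 
  assumes "x \<ge> 0"
  shows "(\<Sum>n<N. x ^ n / fact n) \<le> exp (x::real)"
proof -
  have "(\<lambda>n. x ^ n / fact n) sums exp x"
    using exp_converges[of x] by (simp add: divide_inverse mult.commute)
  then show ?thesis
    using assms sum_le_suminf[of "\<lambda>n. x ^ n / fact n" "{..<N}"]
    by (simp add: sums_iff)
qed

text \<open>
  Pairing with \<open>P\<close> times an exponential is an entire function of the frequency, whose Taylor
  coefficients are the pairings with \<open>P z (z - \<beta>)\<^sup>n\<close>. Through the reproducing property this turns
  functional equations for elements of the Fock space into identities between pairings. The general
  centre \<open>\<beta>\<close> is needed because the symbol \<open>A z + B\<close> shifts the origin.
\<close>

lemma fock_inner_exp_series:
  assumes v: "v \<in> gaussian_L2" and P: "exponential_type P"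
  shows "(\<lambda>n. fock_inner v (\<lambda>z. P z * (z - \<beta>) ^ n) / fact n * t ^ n)
      sums fock_inner v (\<lambda>z. P z * exp (cnj t * (z - \<beta>)))"
proof -
  obtain K \<kappa> where K: "\<And>z. cmod (P z) \<le> K * exp (\<kappa> * cmod z)"
    using P unfolding exponential_type_def by blast
  have [measurable]: "P \<in> borel_measurable borel"
    using P by (auto simp: exponential_type_def intro: entire_borel_measurable)
  define F where "F n z = cnj t ^ n / fact n * (P z * (z - \<beta>) ^ n)" for n z
  define W where "W z = complex_of_real (cmod (P z) * exp (cmod t * cmod (z - \<beta>)))" for z
  have "(\<lambda>n. fock_inner v (F n)) sums fock_inner v (\<lambda>z. P z * exp (cnj t * (z - \<beta>)))"
  proof (rule fock_inner_sums_right[OF v])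
    show "F n \<in> borel_measurable borel" for n unfolding F_def by measurable
    show "(\<lambda>n. F n z) sums (P z * exp (cnj t * (z - \<beta>)))" for z
      using sums_mult[OF exp_converges[of "cnj t * (z - \<beta>)"], of "P z"]
      by (simp add: F_def power_mult_distrib scaleR_conv_of_real divide_inverse mult_ac)
    have "(\<Sum>n<N. cmod (F n z)) = cmod (P z) * (\<Sum>n<N. (cmod t * cmod (z - \<beta>)) ^ n / fact n)" for N z
      by (simp add: F_def norm_mult norm_divide norm_power power_mult_distrib sum_distrib_left mult_ac)
    then show "(\<Sum>n<N. cmod (F n z)) \<le> cmod (W z)" for N z
      by (simp add: W_def norm_mult mult_left_mono sum_exp_series_le)
    show "W \<in> gaussian_L2"
    proof (rule gaussian_L2_growth)
      show "W \<in> borel_measurable borel" unfolding W_def by measurable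
      fix z
      have "cmod (P z) * exp (cmod t * cmod (z - \<beta>))
          \<le> (K * exp (\<kappa> * cmod z)) * exp (cmod t * (cmod z + cmod \<beta>))"
        by (intro mult_mono K order_trans[OF norm_ge_zero K])
           (auto intro!: mult_left_mono norm_triangle_ineq4)
      then show "cmod (W z) \<le> (K * exp (cmod t * cmod \<beta>)) * exp ((\<kappa> + cmod t) * cmod z + 0 / 2 * (cmod z)\<^sup>2)"
        by (simp add: W_def norm_mult exp_add ring_distribs mult_ac)
    qed simp
  qed
  then show ?thesis
    unfolding F_def fock_inner_scale_right by (simp add: mult_ac)
qed

lemma entire_powser_unique:
  fixes a b :: "nat \<Rightarrow> complex"
  assumes "\<And>t. (\<lambda>n. a n * t ^ n) sums f t" "\<And>t. (\<lambda>n. b n * t ^ n) sums f t"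
  shows "a = b"
proof -
  have "f has_fps_expansion Abs_fps a" "f has_fps_expansion Abs_fps b"
    using assms by (auto intro!: has_fps_expansionI)
  then have "Abs_fps a = Abs_fps b"
    by (rule fps_expansion_unique_complex)
  then show ?thesis by (metis fps_nth_Abs_fps ext)
qed

lemma entire_taylor_sums:
  assumes "f holomorphic_on UNIV"
  shows "(\<lambda>n. (deriv ^^ n) f w / fact n * t ^ n) sums f (w + t)"
  using holomorphic_power_series[of f w "cmod t + 1" "w + t"] assms
  by (auto intro: holomorphic_on_subset simp: dist_norm)

lemma fock_reproducing_deriv:
  assumes v: "v \<in> fock_space"
  shows "fock_inner v (\<lambda>z. z ^ n * exp (cnj w * z)) = (deriv ^^ n) v w"
proof -
  have "(\<lambda>n. fock_inner v (\<lambda>z. exp (cnj w * z) * (z - 0) ^ n) / fact n * t ^ n) sums v (w + t)" for t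
  proof -
    have "(\<lambda>z. exp (cnj w * z) * exp (cnj t * (z - 0))) = (\<lambda>z. exp (cnj (w + t) * z))"
      by (simp add: exp_add ring_distribs)
    then show ?thesis
      using fock_inner_exp_series[OF fock_space_L2[OF v] exponential_type_linear(2)[of "cnj w"], of 0 t]
      by (simp only: fock_reproducing[OF v])
  qed
  moreover have "(\<lambda>n. (deriv ^^ n) v w / fact n * t ^ n) sums v (w + t)" for t
    by (rule entire_taylor_sums[OF fock_space_entire[OF v]])
  ultimately have "(\<lambda>n. fock_inner v (\<lambda>z. exp (cnj w * z) * (z - 0) ^ n) / fact n)
      = (\<lambda>n. (deriv ^^ n) v w / fact n)"
    by (rule entire_powser_unique[where f="\<lambda>t. v (w + t)"])
  from fun_cong[OF this, of n] show ?thesis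
    by (simp add: mult.commute)
qed

text \<open>
  Multiplication by \<open>a z + b\<close> is the formal adjoint of \<open>cnj a \<partial> + cnj b\<close>; this is where the sum
  in the definition of \<^const>\<open>S_hat_max\<close> comes from.
\<close>

lemma fock_inner_affine_power:
  assumes v: "v \<in> fock_space"
  shows "fock_inner v (\<lambda>z. (a * z + b) ^ m * exp (cnj w * z))
    = (\<Sum>j\<le>m. of_nat (m choose j) * cnj a ^ j * cnj b ^ (m - j) * (deriv ^^ j) v w)"
proof -
  have "(\<lambda>z. (a * z + b) ^ m * exp (cnj w * z))
      = (\<lambda>z. \<Sum>j\<le>m. (of_nat (m choose j) * a ^ j * b ^ (m - j)) * (z ^ j * exp (cnj w * z)))"
    by (simp add: binomial_ring power_mult_distrib sum_distrib_left sum_distrib_right mult_ac)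
  moreover have "(\<lambda>z. c * (z ^ j * exp (cnj w * z))) \<in> gaussian_L2" for c j
    by (intro fock_space_L2 exponential_type_imp_fock exponential_type_intros exponential_type_linear)
  ultimately show ?thesis
    using v by (simp add: fock_inner_sum_right fock_space_L2 fock_inner_scale_right fock_reproducing_deriv)
qed

section \<open>The adjoint lies in the candidate\<close>

lemma higher_deriv_exp_linear:
  "(deriv ^^ n) (\<lambda>z. c * exp (\<mu> * z)) = (\<lambda>z. c * \<mu> ^ n * exp (\<mu> * z :: complex))"
proof (induction n)
  case (Suc n)
  have "deriv (\<lambda>z. c * \<mu> ^ n * exp (\<mu> * z)) z = c * \<mu> ^ Suc n * exp (\<mu> * z)" for z
    by (rule DERIV_imp_deriv) (auto intro!: derivative_eq_intros)
  with Suc show ?case by auto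
qed simp

text \<open>
  For each \<open>w\<close> the defining equation at \<open>w\<close> is the adjoint relation tested against one pair of the
  graph: a multiple of \<open>(a z + b)\<^sup>m K\<^sub>w\<close> together with a multiple of the kernel at
  \<open>cnj A w + cnj D\<close>.
\<close>

lemma adjoint_subset_S_hat_max:
  "mv_adjoint
     (S_max m (\<lambda>z. C * exp (D * z)) (\<lambda>z. A * z + B) (\<lambda>z. (a * A * z + a * B + b) ^ m))
   \<subseteq> S_hat_max m a b (\<lambda>z. cnj C * exp (cnj B * z)) (\<lambda>z. cnj A * z + cnj D) (\<lambda>z. (cnj A * z + cnj D) ^ m)"
  (is "mv_adjoint ?S \<subseteq> ?T")
proof clarify
  fix u v assume uv: "(u, v) \<in> mv_adjoint ?S"
  then have u: "u \<in> fock_space" and v: "v \<in> fock_space"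
    and adj: "\<And>f g. (f, g) \<in> ?S \<Longrightarrow> fock_inner g u = fock_inner f v"
    by (auto simp: mv_adjoint_def)
  have "cnj C * exp (cnj B * w) * u (cnj A * w + cnj D) = (cnj A * w + cnj D) ^ m *
      (\<Sum>j\<le>m. of_nat (m choose j) * cnj a ^ j * cnj b ^ (m - j) * (deriv ^^ j) v w)" for w
  proof -
    \<comment> \<open>The factor \<open>\<mu> ^ m\<close> is put on \<open>f\<close> instead of dividing \<open>g\<close> by it, since \<open>\<mu>\<close> may vanish.\<close>
    define \<mu> where "\<mu> = A * cnj w + D"
    define g where "g z = C * exp (B * cnj w) * exp (\<mu> * z)" for z
    define f where "f z = \<mu> ^ m * ((a * z + b) ^ m * exp (cnj w * z))" for z
    have "f \<in> fock_space" "g \<in> fock_space"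
      unfolding f_def g_def
      by (intro exponential_type_imp_fock exponential_type_intros exponential_type_linear)+
    moreover have "C * exp (D * z) * f (A * z + B) = (a * A * z + a * B + b) ^ m * (deriv ^^ m) g z" for z
    proof -
      have "exp (D * z) * exp (cnj w * (A * z + B)) = exp (B * cnj w) * exp (\<mu> * z)"
        by (simp add: \<mu>_def algebra_simps flip: exp_add)
      then show ?thesis
        unfolding f_def g_def higher_deriv_exp_linear by (simp add: algebra_simps)
    qed
    ultimately have "(f, g) \<in> ?S" by (simp add: S_max_def)
    then have "fock_inner u g = fock_inner v f"
      using adj fock_inner_cnj by metis
    moreover have "fock_inner u g = cnj C * exp (cnj B * w) * u (cnj A * w + cnj D)"
      using fock_reproducing[OF u, of "cnj \<mu>"]
      unfolding g_def fock_inner_scale_right by (simp add: \<mu>_def exp_cnj)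
    moreover have "fock_inner v f = (cnj A * w + cnj D) ^ m *
      (\<Sum>j\<le>m. of_nat (m choose j) * cnj a ^ j * cnj b ^ (m - j) * (deriv ^^ j) v w)"
      unfolding f_def fock_inner_scale_right fock_inner_affine_power[OF v] by (simp add: \<mu>_def)
    ultimately show ?thesis by simp
  qed
  with u v show "(u, v) \<in> ?T" by (simp add: S_hat_max_def)
qed

section \<open>Weak limits in the Gaussian space\<close>

lemma gaussian_L2_add:
  assumes "F \<in> gaussian_L2" "G \<in> gaussian_L2"
  shows "(\<lambda>z. F z + G z) \<in> gaussian_L2"
proof -
  have [measurable]: "F \<in> borel_measurable borel" "G \<in> borel_measurable borel"
    using assms by (auto simp: gaussian_L2_def)
  have "integrable lborel (\<lambda>z. (cmod (F z + G z))\<^sup>2 * exp (- (cmod z)\<^sup>2))"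
  proof (rule Bochner_Integration.integrable_bound)
    show "integrable lborel (\<lambda>z. 2 * ((cmod (F z))\<^sup>2 * exp (- (cmod z)\<^sup>2)) + 2 * ((cmod (G z))\<^sup>2 * exp (- (cmod z)\<^sup>2)))"
      using assms by (auto simp: gaussian_L2_def)
    have "(cmod (F z + G z))\<^sup>2 \<le> 2 * (cmod (F z))\<^sup>2 + 2 * (cmod (G z))\<^sup>2" for z
    proof -
      have "(cmod (F z + G z))\<^sup>2 \<le> (cmod (F z) + cmod (G z))\<^sup>2"
        by (intro power_mono norm_triangle_ineq) auto
      then show ?thesis
        using two_mult_le_sum_squares[of "cmod (F z)" "cmod (G z)"] by (simp add: power2_sum)
    qed
    then have "(cmod (F z + G z))\<^sup>2 * exp (- (cmod z)\<^sup>2)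
        \<le> (2 * (cmod (F z))\<^sup>2 + 2 * (cmod (G z))\<^sup>2) * exp (- (cmod z)\<^sup>2)" for z
      by (intro mult_right_mono) auto
    then show "AE z in lborel. norm ((cmod (F z + G z))\<^sup>2 * exp (- (cmod z)\<^sup>2))
        \<le> norm (2 * ((cmod (F z))\<^sup>2 * exp (- (cmod z)\<^sup>2)) + 2 * ((cmod (G z))\<^sup>2 * exp (- (cmod z)\<^sup>2)))"
      by (intro AE_I2) (simp add: algebra_simps)
  qed measurable
  then show ?thesis by (simp add: gaussian_L2_def)
qed

lemma continuous_bounded_cball:
  fixes h :: "complex \<Rightarrow> complex"
  assumes "continuous_on UNIV h"
  obtains M where "\<And>z. cmod z \<le> R \<Longrightarrow> cmod (h z) \<le> M"
proof -
  have "compact (h ` cball 0 R)"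
    using assms by (intro compact_continuous_image) (auto intro: continuous_on_subset)
  then have "bounded (h ` cball 0 R)" by (rule compact_imp_bounded)
  then obtain M where "\<forall>x\<in>h ` cball 0 R. cmod x \<le> M" unfolding bounded_iff by blast
  then show thesis by (intro that[of M]) auto
qed

text \<open>
  Dividing \<open>f = (a z + b)\<^sup>m h\<close> by its polynomial factor gains full polynomial decay of order \<open>m\<close>: away
  from the zero, \<open>|a z + b|\<close> is comparable to \<open>1 + |z|\<close>, and near it \<open>h\<close> is bounded. The conclusion
  is free of the zero, so it survives the displacements of the argument of \<open>h\<close> made below.
\<close>

lemma gaussian_L2_cofactor:
  assumes h: "h holomorphic_on UNIV" and a: "a \<noteq> 0"
    and f: "(\<lambda>z. (a * z + b) ^ m * h z) \<in> gaussian_L2"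
  shows "(\<lambda>z. of_real ((1 + cmod z) ^ m) * h z) \<in> gaussian_L2"
proof -
  note [measurable] = entire_borel_measurable[OF h]
  \<comment> \<open>Outside the disc of radius \<open>R\<close> one has \<open>1 + |z| \<le> c |a z + b|\<close>.\<close>
  define R where "R = 1 + 2 * cmod b / cmod a"
  define c where "c = 2 / cmod a"
  have a': "cmod a > 0" using a by simp
  have R: "R \<ge> 0" by (simp add: R_def)
  obtain M where M: "\<And>z. cmod z \<le> R \<Longrightarrow> cmod (h z) \<le> M"
    using continuous_bounded_cball[OF holomorphic_on_imp_continuous_on[OF h]] by blast
  have M0: "M \<ge> 0" using order_trans[OF norm_ge_zero M[of 0]] R by simp
  define W where "W z = complex_of_real ((1 + R) ^ m * M) + of_real (c ^ m * cmod ((a * z + b) ^ m * h z))" for z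
  show ?thesis
  proof (rule gaussian_L2_bound[where W=W])
    have "(\<lambda>z. complex_of_real ((1 + R) ^ m * M)) \<in> gaussian_L2"
      by (intro fock_space_L2 exponential_type_imp_fock exponential_type_const)
    moreover have "(\<lambda>z. complex_of_real (c ^ m * cmod ((a * z + b) ^ m * h z))) \<in> gaussian_L2"
    proof (rule gaussian_L2_bound)
      show "(\<lambda>z. complex_of_real (c ^ m) * ((a * z + b) ^ m * h z)) \<in> gaussian_L2"
        using f by (simp add: gaussian_L2_def norm_mult norm_power power_mult_distrib mult.assoc)
    qed (auto simp: norm_mult norm_power)
    ultimately show "W \<in> gaussian_L2" unfolding W_def by (rule gaussian_L2_add)
    fix z
    have c0: "c \<ge> 0" by (simp add: c_def)
    have "(1 + cmod z) ^ m * cmod (h z) \<le> (1 + R) ^ m * M + c ^ m * cmod ((a * z + b) ^ m * h z)"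
    proof (cases "cmod z \<le> R")
      case True
      then have "(1 + cmod z) ^ m * cmod (h z) \<le> (1 + R) ^ m * M"
        using R by (intro mult_mono power_mono M) auto
      moreover have "0 \<le> c ^ m * cmod ((a * z + b) ^ m * h z)" using c0 by simp
      ultimately show ?thesis by linarith
    next
      case False
      have "cmod a * cmod z \<le> cmod (a * z + b) + cmod b"
        using norm_triangle_ineq4[of "a * z + b" b] by (simp add: norm_mult)
      then have "c * (cmod a * cmod z) \<le> c * (cmod (a * z + b) + cmod b)"
        using c0 by (rule mult_left_mono)
      moreover have "c * (cmod a * cmod z) = 2 * cmod z" "c * cmod b = 2 * cmod b / cmod a"
        using a' by (auto simp: c_def)
      ultimately have "1 + cmod z \<le> c * cmod (a * z + b)"
        using False by (simp add: R_def ring_distribs)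
      then have "(1 + cmod z) ^ m * cmod (h z) \<le> (c * cmod (a * z + b)) ^ m * cmod (h z)"
        by (intro mult_right_mono power_mono) auto
      moreover have "0 \<le> (1 + R) ^ m * M" using R M0 by simp
      ultimately show ?thesis by (simp add: norm_mult norm_power power_mult_distrib mult.assoc)
    qed
    moreover have "0 \<le> (1 + R) ^ m * M + c ^ m * cmod ((a * z + b) ^ m * h z)"
      using R M0 c0 by simp
    ultimately show "cmod (of_real ((1 + cmod z) ^ m) * h z) \<le> cmod (W z)"
      unfolding W_def of_real_add[symmetric] norm_of_real by (simp add: norm_mult norm_power flip: of_real_power)
  qed measurable
qed

lemma
  fixes Q :: "'a::euclidean_space \<Rightarrow> real"
  assumes Q: "integrable lborel Q" and s: "s > 0"
  shows integrable_lborel_affine: "integrable lborel (\<lambda>z. Q (c + s *\<^sub>R z))"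
    and integral_lborel_affine: "(LINT z|lborel. Q (c + s *\<^sub>R z)) = (LINT z|lborel. Q z) / s ^ DIM('a)"
proof -
  let ?T = "\<lambda>z::'a. c + s *\<^sub>R z"
  have [measurable]: "Q \<in> borel_measurable borel" using Q by simp
  have T[measurable]: "?T \<in> borel_measurable borel" by simp
  have eq: "(lborel :: 'a measure) = density (distr lborel borel ?T) (\<lambda>_. ennreal (s ^ DIM('a)))"
    using lborel_affine[of s c] s by simp
  have p: "s ^ DIM('a) > 0" using s by simp
  have "integrable (density (distr lborel borel ?T) (\<lambda>_. ennreal (s ^ DIM('a)))) Q"
    using Q eq by simp
  then have "integrable lborel (\<lambda>z. s ^ DIM('a) *\<^sub>R Q (?T z))"
    using p by (subst (asm) integrable_density) (auto simp: integrable_distr_eq)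
  then show "integrable lborel (\<lambda>z. Q (c + s *\<^sub>R z))" using s by simp
  have "(LINT z|lborel. Q z) = (LINT z|density (distr lborel borel ?T) (\<lambda>_. ennreal (s ^ DIM('a))). Q z)"
    using eq by simp
  also have "\<dots> = (LINT z|distr lborel borel ?T. s ^ DIM('a) *\<^sub>R Q z)"
    using p by (intro integral_density) auto
  also have "\<dots> = s ^ DIM('a) * (LINT z|lborel. Q (?T z))"
    by (subst integral_distr) auto
  finally show "(LINT z|lborel. Q (c + s *\<^sub>R z)) = (LINT z|lborel. Q z) / s ^ DIM('a)"
    using p s by simp
qed

lemma gaussian_tail_small:
  assumes v: "v \<in> gaussian_L2" and e: "\<epsilon> > 0"
  obtains R :: nat where "(LINT z|lborel. indicator {z. cmod z > R} z * ((cmod (v z))\<^sup>2 * exp (- (cmod z)\<^sup>2))) < \<epsilon>"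
proof -
  have [measurable]: "v \<in> borel_measurable borel" using v by (simp add: gaussian_L2_def)
  have "(\<lambda>R::nat. LINT z|lborel. indicator {z. cmod z > R} z * ((cmod (v z))\<^sup>2 * exp (- (cmod z)\<^sup>2)))
      \<longlonglongrightarrow> (LINT z|(lborel :: complex measure). 0)"
  proof (rule integral_dominated_convergence)
    show "integrable lborel (\<lambda>z. (cmod (v z))\<^sup>2 * exp (- (cmod z)\<^sup>2))"
      using v by (simp add: gaussian_L2_def)
    have "(\<lambda>R::nat. indicator {z. cmod z > R} z * ((cmod (v z))\<^sup>2 * exp (- (cmod z)\<^sup>2))) \<longlonglongrightarrow> 0" for z
    proof (rule tendsto_eventually)
      obtain R0 :: nat where "cmod z \<le> R0" using real_arch_simple by blast
      then show "\<forall>\<^sub>F R::nat in sequentially. indicator {z. cmod z > R} z * ((cmod (v z))\<^sup>2 * exp (- (cmod z)\<^sup>2)) = 0"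
        by (intro eventually_sequentiallyI[of R0]) (auto simp: indicator_def)
    qed
    then show "AE z in lborel. (\<lambda>R::nat. indicator {z. cmod z > R} z * ((cmod (v z))\<^sup>2 * exp (- (cmod z)\<^sup>2))) \<longlonglongrightarrow> 0"
      by simp
    show "AE z in lborel. norm (indicator {z. cmod z > real R} z * ((cmod (v z))\<^sup>2 * exp (- (cmod z)\<^sup>2)))
        \<le> (cmod (v z))\<^sup>2 * exp (- (cmod z)\<^sup>2)" for R
      by (intro AE_I2) (auto simp: indicator_def)
  qed measurable
  then have "\<forall>\<^sub>F R::nat in sequentially. (LINT z|lborel. indicator {z. cmod z > R} z * ((cmod (v z))\<^sup>2 * exp (- (cmod z)\<^sup>2))) < \<epsilon>"
    using e by (intro order_tendstoD(2)[of _ 0]) auto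
  then show thesis
    using that eventually_happens'[OF sequentially_bot] by blast
qed

text \<open>
  Bounded norms and pointwise convergence give weak convergence. The dilations considered below need
  not have a square integrable majorant, so dominated convergence is available only on discs; outside a large disc
  the pairing is small uniformly in \<open>n\<close>, because \<open>v\<close> has little mass there and the norms are bounded.
\<close>

lemma fock_inner_weak_limit:
  assumes v: "v \<in> gaussian_L2" and S: "S \<in> gaussian_L2" and F: "\<And>n::nat. F n \<in> gaussian_L2"
    and M: "\<And>n. (LINT z|lborel. (cmod (F n z))\<^sup>2 * exp (- (cmod z)\<^sup>2)) \<le> M"
    and loc: "\<And>R::nat. \<exists>K. \<forall>n z. cmod z \<le> R \<longrightarrow> cmod (F n z) \<le> K"
    and lim: "\<And>z. (\<lambda>n. F n z) \<longlonglongrightarrow> S z"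
  shows "(\<lambda>n. fock_inner v (F n)) \<longlonglongrightarrow> fock_inner v S"
proof -
  have [measurable]: "v \<in> borel_measurable borel" "S \<in> borel_measurable borel" "F n \<in> borel_measurable borel" for n
    using v S F by (auto simp: gaussian_L2_def)
  let ?w = "\<lambda>z. exp (- (cmod z)\<^sup>2)"
  define N where "N = (LINT z|lborel. (cmod (S z))\<^sup>2 * ?w z)"
  have N0: "N \<ge> 0" by (simp add: N_def)
  have M0: "M \<ge> 0" by (rule order_trans[OF _ M[of 0]]) simp
  define I where "I n = (LINT z|lborel. cmod (v z) * cmod (F n z - S z) * ?w z)" for n
  have D: "(\<lambda>z. F n z - S z) \<in> gaussian_L2" for n
  proof -
    have "(\<lambda>z. - S z) \<in> gaussian_L2" using S by (simp add: gaussian_L2_def)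
    from gaussian_L2_add[OF F this] show ?thesis by simp
  qed
  have D2: "(LINT z|lborel. (cmod (F n z - S z))\<^sup>2 * ?w z) \<le> 2 * M + 2 * N" for n
  proof -
    have "(LINT z|lborel. (cmod (F n z - S z))\<^sup>2 * ?w z)
        \<le> (LINT z|lborel. 2 * ((cmod (F n z))\<^sup>2 * ?w z) + 2 * ((cmod (S z))\<^sup>2 * ?w z))"
    proof (rule integral_mono)
      fix z
      have "(cmod (F n z - S z))\<^sup>2 \<le> (cmod (F n z) + cmod (S z))\<^sup>2"
        by (intro power_mono norm_triangle_ineq4) auto
      also have "\<dots> \<le> 2 * (cmod (F n z))\<^sup>2 + 2 * (cmod (S z))\<^sup>2"
        using two_mult_le_sum_squares[of "cmod (F n z)" "cmod (S z)"] by (simp add: power2_sum)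
      finally have "(cmod (F n z - S z))\<^sup>2 * ?w z \<le> (2 * (cmod (F n z))\<^sup>2 + 2 * (cmod (S z))\<^sup>2) * ?w z"
        by (intro mult_right_mono) auto
      then show "(cmod (F n z - S z))\<^sup>2 * ?w z \<le> 2 * ((cmod (F n z))\<^sup>2 * ?w z) + 2 * ((cmod (S z))\<^sup>2 * ?w z)"
        by (simp add: algebra_simps)
    qed (use D[of n] F[of n] S in \<open>auto simp: gaussian_L2_def\<close>)
    also have "\<dots> = 2 * (LINT z|lborel. (cmod (F n z))\<^sup>2 * ?w z) + 2 * N"
      using F[of n] S by (simp add: gaussian_L2_def N_def)
    finally show ?thesis using M[of n] by linarith
  qed
  have I: "I \<longlonglongrightarrow> 0"
  proof (rule LIMSEQ_I)
    fix \<epsilon> :: real assume e: "\<epsilon> > 0"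
    \<comment> \<open>On the tail, \<open>|v| |F n - S| \<le> (\<tau> |F n - S|\<^sup>2 + |v|\<^sup>2 / \<tau>) / 2\<close>. The first summand integrates to
      at most \<open>\<epsilon> / 3\<close> by the choice of \<open>\<tau>\<close>, the second by the choice of the radius made after it.\<close>
    define \<tau> where "\<tau> = \<epsilon> / (3 * (M + N + 1))"
    have t: "\<tau> > 0" using e M0 N0 by (simp add: \<tau>_def)
    obtain R :: nat where R: "(LINT z|lborel. indicator {z. cmod z > R} z * ((cmod (v z))\<^sup>2 * ?w z)) < \<epsilon> * \<tau> / 3"
      using gaussian_tail_small[OF v, of "\<epsilon> * \<tau> / 3"] e t by auto
    define T where "T = (LINT z|lborel. indicator {z. cmod z > R} z * ((cmod (v z))\<^sup>2 * ?w z))"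
    obtain K where K: "\<And>n z. cmod z \<le> R \<Longrightarrow> cmod (F n z) \<le> K"
      using loc[of R] by blast
    define J where "J n = (LINT z|lborel. indicator {z. cmod z \<le> R} z * (cmod (v z) * cmod (F n z - S z) * ?w z))" for n
    have KL2: "(\<lambda>z. complex_of_real (2 * K)) \<in> gaussian_L2"
      by (intro fock_space_L2 exponential_type_imp_fock exponential_type_const)
    have "J \<longlonglongrightarrow> (LINT z|(lborel :: complex measure). 0)"
      unfolding J_def
    proof (rule integral_dominated_convergence)
      show "integrable lborel (\<lambda>z. cmod (v z) * cmod (complex_of_real (2 * K)) * ?w z)"
        by (rule integrable_norm_pairing[OF v KL2])
      have "(\<lambda>n. cmod (F n z - S z)) \<longlonglongrightarrow> 0" for z
        using lim[of z] by (simp add: LIM_zero tendsto_norm_zero)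
      then show "AE z in lborel. (\<lambda>n. indicator {z. cmod z \<le> R} z * (cmod (v z) * cmod (F n z - S z) * ?w z)) \<longlonglongrightarrow> 0"
        by (intro AE_I2 tendsto_mult_right_zero tendsto_mult_left_zero)
      have "cmod (F n z - S z) \<le> \<bar>2 * K\<bar>" if "cmod z \<le> R" for n z
      proof -
        have "cmod (S z) \<le> K"
          using K[OF that] by (intro LIMSEQ_le_const2[OF tendsto_norm[OF lim]]) auto
        then show ?thesis
          using K[OF that, of n] norm_triangle_ineq4[of "F n z" "S z"] by linarith
      qed
      then show "AE z in lborel. norm (indicator {z. cmod z \<le> R} z * (cmod (v z) * cmod (F n z - S z) * ?w z))
          \<le> cmod (v z) * cmod (complex_of_real (2 * K)) * ?w z" for n
        unfolding norm_of_real
        by (intro AE_I2) (auto simp: indicator_def abs_mult intro!: mult_right_mono mult_left_mono)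
    qed measurable
    then obtain n0 where n0: "\<And>n. n \<ge> n0 \<Longrightarrow> \<bar>J n\<bar> < \<epsilon> / 3"
      using e LIMSEQ_D[of J 0 "\<epsilon> / 3"] by auto
    have IJ: "I n \<le> J n + (\<tau> * (2 * M + 2 * N) + T / \<tau>) / 2" for n
    proof -
      have vD: "integrable lborel (\<lambda>z. cmod (v z) * cmod (F n z - S z) * ?w z)"
        by (rule integrable_norm_pairing[OF v D])
      have i1: "integrable lborel (\<lambda>z. indicator {z. cmod z \<le> R} z * (cmod (v z) * cmod (F n z - S z) * ?w z))"
        by (rule Bochner_Integration.integrable_bound[OF vD]) (auto simp: indicator_def)
      have i2: "integrable lborel (\<lambda>z. (cmod (F n z - S z))\<^sup>2 * ?w z)"
        using D[of n] by (simp add: gaussian_L2_def)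
      have i3: "integrable lborel (\<lambda>z. indicator {z. cmod z > R} z * ((cmod (v z))\<^sup>2 * ?w z))"
      proof (rule Bochner_Integration.integrable_bound)
        show "integrable lborel (\<lambda>z. (cmod (v z))\<^sup>2 * ?w z)" using v by (simp add: gaussian_L2_def)
      qed (auto simp: indicator_def)
      have "I n \<le> (LINT z|lborel. indicator {z. cmod z \<le> R} z * (cmod (v z) * cmod (F n z - S z) * ?w z)
          + (\<tau> / 2 * ((cmod (F n z - S z))\<^sup>2 * ?w z)
             + 1 / (2 * \<tau>) * (indicator {z. cmod z > R} z * ((cmod (v z))\<^sup>2 * ?w z))))"
        unfolding I_def
      proof (rule integral_mono[OF vD])
        fix z
        have "cmod (v z) * cmod (F n z - S z) \<le> \<tau> / 2 * (cmod (F n z - S z))\<^sup>2 + 1 / (2 * \<tau>) * (cmod (v z))\<^sup>2"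
        proof -
          have "2 * ((sqrt \<tau> * cmod (F n z - S z)) * (cmod (v z) / sqrt \<tau>))
              \<le> (sqrt \<tau> * cmod (F n z - S z))\<^sup>2 + (cmod (v z) / sqrt \<tau>)\<^sup>2"
            by (rule two_mult_le_sum_squares)
          then show ?thesis using t by (simp add: power_mult_distrib power_divide mult_ac)
        qed
        then have "cmod (v z) * cmod (F n z - S z) * ?w z
            \<le> (\<tau> / 2 * (cmod (F n z - S z))\<^sup>2 + 1 / (2 * \<tau>) * (cmod (v z))\<^sup>2) * ?w z"
          by (intro mult_right_mono) auto
        moreover have "0 \<le> \<tau> / 2 * ((cmod (F n z - S z))\<^sup>2 * ?w z)" using t by simp
        ultimately show "cmod (v z) * cmod (F n z - S z) * ?w z
            \<le> indicator {z. cmod z \<le> R} z * (cmod (v z) * cmod (F n z - S z) * ?w z)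
          + (\<tau> / 2 * ((cmod (F n z - S z))\<^sup>2 * ?w z)
             + 1 / (2 * \<tau>) * (indicator {z. cmod z > R} z * ((cmod (v z))\<^sup>2 * ?w z)))"
          by (auto simp: indicator_def algebra_simps)
      qed (intro Bochner_Integration.integrable_add integrable_mult_right i1 i2 i3)
      also have "\<dots> = J n + (\<tau> / 2 * (LINT z|lborel. (cmod (F n z - S z))\<^sup>2 * ?w z) + 1 / (2 * \<tau>) * T)"
        using i1 i2 i3 by (simp add: J_def T_def)
      also have "\<dots> \<le> J n + (\<tau> / 2 * (2 * M + 2 * N) + 1 / (2 * \<tau>) * T)"
        using D2[of n] t by (intro add_mono mult_left_mono) auto
      finally show ?thesis using t by (simp add: field_simps)
    qed
    have "(\<tau> * (2 * M + 2 * N) + T / \<tau>) / 2 < 2 * \<epsilon> / 3"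
    proof -
      have "T / \<tau> < \<epsilon> / 3" using R t by (simp add: T_def field_simps)
      moreover have "\<tau> * (M + N) \<le> \<epsilon> / 3"
        using e M0 N0 by (simp add: \<tau>_def field_simps)
      ultimately show ?thesis using e by (simp add: ring_distribs)
    qed
    then have "I n < \<epsilon>" if "n \<ge> n0" for n
      using n0[OF that] IJ[of n] by linarith
    moreover have "0 \<le> I n" for n
      unfolding I_def by (rule integral_nonneg_AE) auto
    ultimately show "\<exists>no. \<forall>n\<ge>no. norm (I n - 0) < \<epsilon>" by auto
  qed
  have le: "cmod (fock_inner v (F n) - fock_inner v S) \<le> 1 / pi * I n" for n
  proof -
    have "fock_inner v (F n) - fock_inner v S
        = of_real (1 / pi) * (LINT z|lborel. v z * cnj (F n z - S z) * of_real (?w z))"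
      unfolding fock_inner_def right_diff_distrib[symmetric]
      by (subst Bochner_Integration.integral_diff[symmetric, OF integrable_pairing[OF v F] integrable_pairing[OF v S]])
         (simp add: algebra_simps)
    also have "cmod \<dots> \<le> 1 / pi * I n"
    proof -
      have "cmod (LINT z|lborel. v z * cnj (F n z - S z) * of_real (?w z)) \<le> I n"
        unfolding I_def
        by (rule order_trans[OF integral_norm_bound])
           (simp only: norm_mult complex_mod_cnj norm_of_real abs_exp_cancel order_refl)
      then show ?thesis
        unfolding norm_mult norm_of_real by (intro mult_mono) auto
    qed
    finally show ?thesis .
  qed
  have "(\<lambda>n. 1 / pi * I n) \<longlonglongrightarrow> 0"
    by (rule tendsto_mult_right_zero[OF I])
  then have "(\<lambda>n. fock_inner v (F n) - fock_inner v S) \<longlonglongrightarrow> 0"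
    by (rule Lim_null_comparison[rotated]) (simp only: le always_eventually simp_thms)
  then show ?thesis by (rule LIM_zero_cancel)
qed

section \<open>Twisted dilations\<close>

text \<open>
  The image of \<open>f = (a z + b)\<^sup>m h\<close> under the twisted dilation with parameter \<open>s\<close>. With
  \<open>d = D / A\<close> it is the conjugate of the plain dilation \<open>g z \<mapsto> g (s z)\<close> by the
  weighted composition with \<open>exp (D z)\<close> and \<open>A z + B\<close>: dilating \<open>g\<close> in a pair of the graph forces this
  change of \<open>f\<close>, up to the scalar \<open>s\<^sup>m\<close>. The displacement \<open>(1 - s) B\<close> and the exponent are of
  order \<open>1 - s\<close>, which keeps the norms bounded as \<open>s \<rightarrow> 1\<close>. The parameters
  \<open>a = 1\<close>, \<open>b = m = B = d = 0\<close> give the plain dilation of \<open>h\<close>.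
\<close>

definition dilation ::
  "complex \<Rightarrow> complex \<Rightarrow> nat \<Rightarrow> complex \<Rightarrow> complex \<Rightarrow> (complex \<Rightarrow> complex) \<Rightarrow> real \<Rightarrow> complex \<Rightarrow> complex" where
  "dilation a b m B d h s z =
     (a * z + b) ^ m * exp (- (of_real (1 - s) * d * (z - B))) * h (of_real s * z + of_real (1 - s) * B)"

text \<open>
  The Gaussian gains \<open>(1 - s\<^sup>2) |x|\<^sup>2\<close> from the contraction, while the displacement and the
  exponential cost only multiples of \<open>(1 - s) |x|\<close>. All terms share the factor \<open>1 - s\<close>, hence the
  bound does not depend on \<open>s\<close>.
\<close>

lemma dilation_exponent_le:
  assumes s: "0 \<le> s" "s \<le> 1"
  shows "2 * (1 - s) * \<delta> * cmod x - (cmod (B + x))\<^sup>2 + (cmod (B + of_real s * x))\<^sup>2 \<le> (cmod B + \<delta>)\<^sup>2"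
proof -
  have c: "- (Re (cnj B * x)) \<le> cmod B * cmod x"
    using complex_Re_le_cmod[of "- (cnj B * x)"] by (simp add: norm_mult)
  have 1: "(cmod (B + of_real s * x))\<^sup>2 - (cmod (B + x))\<^sup>2
      = (1 - s) * (- (1 + s) * (cmod x)\<^sup>2 - 2 * Re (cnj B * x))"
    unfolding cmod_power2 by (simp add: algebra_simps power2_eq_square)
  have "- (1 + s) * (cmod x)\<^sup>2 - 2 * Re (cnj B * x) + 2 * \<delta> * cmod x
      \<le> - (cmod x)\<^sup>2 + 2 * ((cmod B + \<delta>) * cmod x)"
    using c mult_right_mono[of 1 "1 + s" "(cmod x)\<^sup>2"] s by (simp add: algebra_simps)
  also have "\<dots> \<le> (cmod B + \<delta>)\<^sup>2"
    using two_mult_le_sum_squares[of "cmod B + \<delta>" "cmod x"] by linarith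
  finally have 2: "- (1 + s) * (cmod x)\<^sup>2 - 2 * Re (cnj B * x) + 2 * \<delta> * cmod x \<le> (cmod B + \<delta>)\<^sup>2" .
  have "(1 - s) * (- (1 + s) * (cmod x)\<^sup>2 - 2 * Re (cnj B * x) + 2 * \<delta> * cmod x) \<le> (1 - s) * (cmod B + \<delta>)\<^sup>2"
    using 2 s by (intro mult_left_mono) auto
  also have "\<dots> \<le> 1 * (cmod B + \<delta>)\<^sup>2"
    using s by (intro mult_right_mono) auto
  finally show ?thesis using 1 by (simp add: algebra_simps)
qed

text \<open>
  The substitution \<open>y = s z + (1 - s) B\<close> bounds the norms of the dilations by a
  constant times that of \<open>(1 + |y|)\<^sup>m h\<close>. Any sequence of parameters in \<open>[1/2, 1)\<close> that tends to \<open>1\<close> would serve.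
\<close>

lemma dilation_limit:
  assumes v: "v \<in> gaussian_L2" and h: "h holomorphic_on UNIV" and a: "a \<noteq> 0"
    and f: "(\<lambda>z. (a * z + b) ^ m * h z) \<in> gaussian_L2"
  shows "(\<lambda>n. fock_inner v (dilation a b m B d h (1 - 1 / (real n + 2))))
      \<longlonglongrightarrow> fock_inner v (\<lambda>z. (a * z + b) ^ m * h z)"
proof -
  note [measurable] = entire_borel_measurable[OF h]
  have hc: "continuous_on UNIV h" by (rule holomorphic_on_imp_continuous_on[OF h])
  define s where "s n = 1 - 1 / (real n + 2)" for n :: nat
  have s: "1 / 2 \<le> s n" "s n \<le> 1" for n by (auto simp: s_def field_simps)
  have s_lim: "s \<longlonglongrightarrow> 1"
    unfolding s_def by real_asymp
  define Q where "Q y = ((1 + cmod y) ^ m * cmod (h y))\<^sup>2 * exp (- (cmod y)\<^sup>2)" for y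
  have Q: "integrable lborel Q"
    using gaussian_L2_cofactor[OF h a f]
    by (simp add: gaussian_L2_def Q_def[abs_def] norm_mult norm_power flip: of_real_power)
  define c where "c = 2 * cmod a + cmod a * cmod B + cmod b"
  define C where "C = c ^ (2 * m) * exp ((cmod B + cmod d)\<^sup>2)"
  have C0: "C \<ge> 0" by (simp add: C_def c_def)
  have meas[measurable]: "dilation a b m B d h (s n) \<in> borel_measurable borel" for n
    unfolding dilation_def[abs_def] by measurable
  have le: "(cmod (dilation a b m B d h (s n) z))\<^sup>2 * exp (- (cmod z)\<^sup>2)
      \<le> C * Q (of_real (1 - s n) * B + s n *\<^sub>R z)" for n z
  proof -
    define y where "y = of_real (s n) * z + of_real (1 - s n) * B"
    define x where "x = z - B"
    have zx: "z = B + x" "y = B + of_real (s n) * x" by (auto simp: x_def y_def algebra_simps)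
    have "cmod z \<le> 2 * cmod y + cmod B"
    proof -
      have "of_real (s n) * z = y - of_real (1 - s n) * B" by (simp add: y_def)
      then have "s n * cmod z \<le> cmod y + (1 - s n) * cmod B"
        using norm_triangle_ineq4[of y "of_real (1 - s n) * B"] s[of n]
        by (metis abs_of_nonneg diff_ge_0_iff_ge norm_mult norm_of_real order_trans zero_le_divide_1_iff zero_le_numeral)
      moreover have "(1 - s n) * cmod B \<le> s n * cmod B" using s[of n] by (intro mult_right_mono) auto
      moreover have "cmod y \<le> s n * (2 * cmod y)"
        using mult_right_mono[of "1/2" "s n" "2 * cmod y"] s[of n] by simp
      ultimately have "s n * cmod z \<le> s n * (2 * cmod y + cmod B)" by (simp add: algebra_simps)
      then show ?thesis using s(1)[of n] by (simp add: mult_le_cancel_left)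
    qed
    then have "cmod a * cmod z \<le> cmod a * (2 * cmod y + cmod B)" by (intro mult_left_mono) auto
    moreover have "cmod (a * z + b) \<le> cmod a * cmod z + cmod b"
      using norm_triangle_ineq[of "a * z" b] by (simp add: norm_mult)
    ultimately have "cmod (a * z + b) \<le> 2 * cmod a * cmod y + (cmod a * cmod B + cmod b)"
      by (simp add: algebra_simps)
    also have "\<dots> \<le> c * (1 + cmod y)"
      unfolding c_def by (simp add: algebra_simps)
    finally have "cmod (a * z + b) ^ m \<le> (c * (1 + cmod y)) ^ m"
      by (intro power_mono) auto
    then have p: "cmod (a * z + b) ^ m * cmod (h y) \<le> c ^ m * ((1 + cmod y) ^ m * cmod (h y))"
      by (simp add: power_mult_distrib mult.assoc[symmetric] mult_right_mono)
    define \<epsilon> where "\<epsilon> = (1 - s n) * cmod d * cmod x"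
    have "cmod (exp (- (of_real (1 - s n) * d * (z - B)))) \<le> exp \<epsilon>"
      using complex_Re_le_cmod[of "- (of_real (1 - s n) * d * (z - B))"] s[of n]
      by (simp add: \<epsilon>_def norm_mult x_def del: of_real_diff)
    with p have "cmod (a * z + b) ^ m * cmod (h y) * cmod (exp (- (of_real (1 - s n) * d * (z - B))))
        \<le> c ^ m * ((1 + cmod y) ^ m * cmod (h y)) * exp \<epsilon>"
      by (rule mult_mono) (auto simp: c_def)
    moreover have "dilation a b m B d h (s n) z
        = (a * z + b) ^ m * h y * exp (- (of_real (1 - s n) * d * (z - B)))"
      by (simp add: dilation_def y_def mult_ac)
    ultimately have "cmod (dilation a b m B d h (s n) z) \<le> c ^ m * ((1 + cmod y) ^ m * cmod (h y)) * exp \<epsilon>"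
      by (simp add: norm_mult norm_power)
    then have "(cmod (dilation a b m B d h (s n) z))\<^sup>2 * exp (- (cmod z)\<^sup>2)
        \<le> (c ^ m * ((1 + cmod y) ^ m * cmod (h y)) * exp \<epsilon>)\<^sup>2 * exp (- (cmod z)\<^sup>2)"
      by (intro mult_right_mono power_mono) auto
    also have "\<dots> = c ^ (2 * m) * ((1 + cmod y) ^ m * cmod (h y))\<^sup>2 * exp (2 * \<epsilon> - (cmod z)\<^sup>2)"
      unfolding exp_square_mult[symmetric] by (simp add: power_mult_distrib power_mult mult_ac)
    also have "\<dots> \<le> c ^ (2 * m) * ((1 + cmod y) ^ m * cmod (h y))\<^sup>2 * (exp ((cmod B + cmod d)\<^sup>2) * exp (- (cmod y)\<^sup>2))"
    proof -
      have "2 * \<epsilon> - (cmod z)\<^sup>2 \<le> (cmod B + cmod d)\<^sup>2 - (cmod y)\<^sup>2"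
        using dilation_exponent_le[of "s n" "cmod d" x B] s[of n] unfolding zx \<epsilon>_def by (simp add: algebra_simps)
      then have "exp (2 * \<epsilon> - (cmod z)\<^sup>2) \<le> exp ((cmod B + cmod d)\<^sup>2) * exp (- (cmod y)\<^sup>2)"
        by (simp flip: exp_add)
      then show ?thesis by (intro mult_left_mono) (auto simp: c_def)
    qed
    also have "\<dots> = C * Q y" by (simp add: C_def Q_def mult_ac)
    finally show ?thesis by (simp add: y_def scaleR_conv_of_real add.commute)
  qed
  have spos: "s n > 0" for n using s(1)[of n] by simp
  have intb: "integrable lborel (\<lambda>z. C * Q (of_real (1 - s n) * B + s n *\<^sub>R z))" for n
    by (intro integrable_mult_right integrable_lborel_affine[OF Q spos])
  have F: "dilation a b m B d h (s n) \<in> gaussian_L2" for n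
    unfolding gaussian_L2_def
  proof (intro CollectI conjI meas Bochner_Integration.integrable_bound[OF intb])
    have "0 \<le> C * Q y" for y using C0 by (simp add: Q_def)
    then show "AE z in lborel. norm ((cmod (dilation a b m B d h (s n) z))\<^sup>2 * exp (- (cmod z)\<^sup>2))
        \<le> norm (C * Q (of_real (1 - s n) * B + s n *\<^sub>R z))"
      using le by (intro AE_I2) (simp add: order_trans[OF le])
  qed measurable
  have M: "(LINT z|lborel. (cmod (dilation a b m B d h (s n) z))\<^sup>2 * exp (- (cmod z)\<^sup>2))
      \<le> C * (LINT y|lborel. Q y) * 4" for n
  proof -
    have "(LINT z|lborel. (cmod (dilation a b m B d h (s n) z))\<^sup>2 * exp (- (cmod z)\<^sup>2))
        \<le> (LINT z|lborel. C * Q (of_real (1 - s n) * B + s n *\<^sub>R z))"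
      using F by (intro integral_mono intb le) (auto simp: gaussian_L2_def)
    also have "\<dots> = C * (LINT y|lborel. Q y) * (1 / (s n)\<^sup>2)"
      by (simp add: integral_lborel_affine[OF Q spos])
    also have "\<dots> \<le> C * (LINT y|lborel. Q y) * 4"
    proof (rule mult_left_mono)
      have "(1 / 2)\<^sup>2 \<le> (s n)\<^sup>2" using s(1) by (intro power_mono) auto
      then show "1 / (s n)\<^sup>2 \<le> 4" using spos[of n] by (simp add: field_simps power2_eq_square)
      show "0 \<le> C * (LINT y|lborel. Q y)"
        using C0 by (intro mult_nonneg_nonneg integral_nonneg_AE) (auto simp: Q_def)
    qed
    finally show ?thesis .
  qed
  have loc: "\<exists>K. \<forall>n z. cmod z \<le> R \<longrightarrow> cmod (dilation a b m B d h (s n) z) \<le> K" for R :: nat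
  proof -
    obtain M where M: "\<And>y. cmod y \<le> R + cmod B \<Longrightarrow> cmod (h y) \<le> M"
      using continuous_bounded_cball[OF hc] by blast
    have "cmod (dilation a b m B d h (s n) z)
        \<le> (cmod a * R + cmod b) ^ m * exp (cmod d * (R + cmod B)) * M" if z: "cmod z \<le> R" for n z
    proof -
      have "cmod (a * z + b) \<le> cmod a * R + cmod b"
        using norm_triangle_ineq[of "a * z" b] mult_left_mono[OF z, of "cmod a"] by (simp add: norm_mult)
      then have 1: "cmod (a * z + b) ^ m \<le> (cmod a * R + cmod b) ^ m"
        by (intro power_mono) auto
      have "Re (- (of_real (1 - s n) * d * (z - B))) \<le> (1 - s n) * (cmod d * cmod (z - B))"
        using complex_Re_le_cmod[of "- (of_real (1 - s n) * d * (z - B))"] s[of n]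
        by (simp add: norm_mult del: of_real_diff)
      also have "\<dots> \<le> 1 * (cmod d * (R + cmod B))"
        using s[of n] z norm_triangle_ineq4[of z B] by (intro mult_mono) auto
      finally have 2: "cmod (exp (- (of_real (1 - s n) * d * (z - B)))) \<le> exp (cmod d * (R + cmod B))"
        by simp
      have "cmod (of_real (s n) * z + of_real (1 - s n) * B) \<le> s n * cmod z + (1 - s n) * cmod B"
        using s[of n] spos[of n] by (intro norm_triangle_le) (simp add: norm_mult del: of_real_diff)
      also have "\<dots> \<le> 1 * real R + 1 * cmod B"
        using s[of n] z spos[of n] by (intro add_mono mult_mono) auto
      finally have 3: "cmod (h (of_real (s n) * z + of_real (1 - s n) * B)) \<le> M"
        by (intro M) simp
      show ?thesis
        unfolding dilation_def norm_mult norm_power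
        using 1 2 3 by (intro mult_mono) auto
    qed
    then show ?thesis by blast
  qed
  have lim: "(\<lambda>n. dilation a b m B d h (s n) z) \<longlonglongrightarrow> (a * z + b) ^ m * h z" for z
  proof -
    have "(\<lambda>n. of_real (s n) * z + of_real (1 - s n) * B) \<longlonglongrightarrow> of_real 1 * z + of_real (1 - 1) * B"
      by (intro tendsto_intros s_lim)
    then have "(\<lambda>n. of_real (s n) * z + of_real (1 - s n) * B) \<longlonglongrightarrow> z" by simp
    moreover have "isCont h z" using hc by (simp add: continuous_on_eq_continuous_at)
    ultimately have "(\<lambda>n. h (of_real (s n) * z + of_real (1 - s n) * B)) \<longlonglongrightarrow> h z"
      by (rule isCont_tendsto_compose[rotated])
    then have "(\<lambda>n. dilation a b m B d h (s n) z)
        \<longlonglongrightarrow> (a * z + b) ^ m * exp (- (of_real (1 - 1) * d * (z - B))) * h z"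
      unfolding dilation_def by (intro tendsto_intros s_lim)
    then show ?thesis by simp
  qed
  show ?thesis
    using fock_inner_weak_limit[OF v f F M loc lim] by (simp add: s_def)
qed

text \<open>
  The key expansion. In terms of \<open>x = z - B\<close> the dilation equals \<open>(a z + b)\<^sup>m exp (- d x) G (s x)\<close> with
  the entire function \<open>G t = exp (d t) h (B + t)\<close>, so it is a power series in \<open>s\<close>. For \<open>s < 1\<close> it may be
  paired with \<open>v\<close> term by term: Cauchy's inequality on the circle of radius \<open>\<surd>s (|x| + 1)\<close>
  bounds the \<open>n\<close>-th term by \<open>(\<surd>s)\<^sup>n\<close> times a function of growth \<open>exp (s |x|\<^sup>2 / 2)\<close>, up to an
  exponential of linear growth.
\<close>

lemma dilation_series:
  assumes v: "v \<in> gaussian_L2" and h: "h \<in> fock_space"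
    and s: "0 < s" "s < 1"
    and q: "\<And>t. (\<lambda>n. q n * t ^ n) sums (exp (d * t) * h (B + t))"
  shows "(\<lambda>n. cnj (q n) * of_real s ^ n *
        fock_inner v (\<lambda>z. ((a * z + b) ^ m * exp (- (d * (z - B)))) * (z - B) ^ n))
      sums fock_inner v (dilation a b m B d h s)"
proof -
  define P where "P z = (a * z + b) ^ m * exp (- (d * (z - B)))" for z
  have P: "exponential_type P"
  proof -
    have "P = (\<lambda>z. (a * z + b) ^ m * exp (- d * z + d * B))"
      by (simp add: fun_eq_iff P_def algebra_simps)
    then show ?thesis by (simp only: exponential_type_intros)
  qed
  then obtain L \<kappa> where L: "\<And>z. cmod (P z) \<le> L * exp (\<kappa> * cmod z)"
    unfolding exponential_type_def by blast
  have [measurable]: "P \<in> borel_measurable borel"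
    using P by (auto simp: exponential_type_def intro: entire_borel_measurable)
  obtain K where K: "K \<ge> 0" "\<And>w. cmod (h w) \<le> K * exp ((cmod w)\<^sup>2 / 2)"
    using fock_pointwise_bound[OF h] by blast
  define \<sigma> where "\<sigma> = sqrt s"
  have sg: "0 < \<sigma>" "\<sigma> < 1" "\<sigma> * \<sigma> = s" using s by (auto simp: \<sigma>_def)
  define \<beta> where "\<beta> = cmod B + 1"
  \<comment> \<open>The summand \<open>1\<close> keeps the radius positive at \<open>z = B\<close>.\<close>
  define \<rho> where "\<rho> z = \<sigma> * (cmod (z - B) + 1)" for z
  have \<rho>: "\<rho> z > 0" "\<rho> z \<le> cmod z + \<beta>" "(\<rho> z)\<^sup>2 \<le> s * (cmod z + \<beta>)\<^sup>2" for z
  proof -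
    have le: "cmod (z - B) + 1 \<le> cmod z + \<beta>" using norm_triangle_ineq4[of z B] by (simp add: \<beta>_def)
    show "\<rho> z > 0" using sg by (auto simp: \<rho>_def intro!: mult_pos_pos add_nonneg_pos)
    have "\<rho> z \<le> 1 * (cmod (z - B) + 1)" unfolding \<rho>_def using sg by (intro mult_right_mono) auto
    with le show "\<rho> z \<le> cmod z + \<beta>" by simp
    have "(\<rho> z)\<^sup>2 = s * (cmod (z - B) + 1)\<^sup>2"
      using sg(3) by (simp add: \<rho>_def power2_eq_square mult_ac)
    also have "\<dots> \<le> s * (cmod z + \<beta>)\<^sup>2" using le s by (intro mult_left_mono power_mono) auto
    finally show "(\<rho> z)\<^sup>2 \<le> s * (cmod z + \<beta>)\<^sup>2" .
  qed
  define Y where "Y z = K * exp (cmod d * \<rho> z + (cmod B + \<rho> z)\<^sup>2 / 2)" for z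
  have Y0: "Y z \<ge> 0" for z using K(1) by (simp add: Y_def)
  define G where "G t = exp (d * t) * h (B + t)" for t
  have G: "G holomorphic_on UNIV"
    using entire_affine[OF fock_space_entire[OF h], of 1 B] unfolding G_def
    by (intro holomorphic_intros) (simp add: add.commute)
  have qG: "q n = (deriv ^^ n) G 0 / fact n" for n
  proof -
    have "q = (\<lambda>n. (deriv ^^ n) G 0 / fact n)"
      using entire_taylor_sums[OF G, of 0] q by (intro entire_powser_unique[where f=G]) (auto simp: G_def)
    then show ?thesis by simp
  qed
  have cauchy: "cmod (q n) * (s * cmod (z - B)) ^ n \<le> Y z * \<sigma> ^ n" for n z
  proof -
    have "cmod ((deriv ^^ n) G 0) \<le> fact n * Y z / \<rho> z ^ n"
    proof (rule Cauchy_inequality)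
      show "G holomorphic_on ball 0 (\<rho> z)" using G by (rule holomorphic_on_subset) simp
      show "continuous_on (cball 0 (\<rho> z)) G"
        using holomorphic_on_imp_continuous_on[OF G] by (rule continuous_on_subset) simp
      fix x :: complex assume x: "cmod (0 - x) = \<rho> z"
      have "cmod (exp (d * x)) \<le> exp (cmod d * \<rho> z)"
        using complex_Re_le_cmod[of "d * x"] x by (simp add: norm_mult)
      moreover have "cmod (h (B + x)) \<le> K * exp ((cmod B + \<rho> z)\<^sup>2 / 2)"
      proof -
        have "(cmod (B + x))\<^sup>2 \<le> (cmod B + \<rho> z)\<^sup>2"
          using norm_triangle_ineq[of B x] x by (intro power_mono) auto
        then have "K * exp ((cmod (B + x))\<^sup>2 / 2) \<le> K * exp ((cmod B + \<rho> z)\<^sup>2 / 2)"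
          using K(1) by (intro mult_left_mono) auto
        with K(2)[of "B + x"] show ?thesis by linarith
      qed
      ultimately have "cmod (exp (d * x)) * cmod (h (B + x)) \<le> exp (cmod d * \<rho> z) * (K * exp ((cmod B + \<rho> z)\<^sup>2 / 2))"
        by (intro mult_mono) auto
      then show "cmod (G x) \<le> Y z"
        by (simp add: G_def Y_def norm_mult exp_add mult_ac)
    qed (rule \<rho>)
    then have 1: "cmod (q n) \<le> Y z / \<rho> z ^ n"
      by (simp add: qG norm_divide field_simps)
    have "s * cmod (z - B) \<le> \<sigma> * \<rho> z"
      using sg s by (simp add: \<rho>_def algebra_simps flip: sg(3))
    then have 2: "(s * cmod (z - B)) ^ n \<le> (\<sigma> * \<rho> z) ^ n"
      using s by (intro power_mono) auto
    have "cmod (q n) * (s * cmod (z - B)) ^ n \<le> (Y z / \<rho> z ^ n) * (\<sigma> * \<rho> z) ^ n"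
      using 1 2 s Y0[of z] \<rho>(1)[of z] by (intro mult_mono) auto
    also have "\<dots> = Y z * \<sigma> ^ n"
      using \<rho>(1)[of z] by (simp add: power_mult_distrib)
    finally show ?thesis .
  qed
  define F where "F n z = (q n * of_real s ^ n) * (P z * (z - B) ^ n)" for n z
  define W where "W z = complex_of_real (cmod (P z) * (Y z / (1 - \<sigma>)))" for z
  have norm_W: "cmod (W z) = cmod (P z) * (Y z / (1 - \<sigma>))" for z
    unfolding W_def norm_of_real using Y0[of z] sg by simp
  have "(\<lambda>n. fock_inner v (F n)) sums fock_inner v (dilation a b m B d h s)"
  proof (rule fock_inner_sums_right[OF v])
    show "F n \<in> borel_measurable borel" for n unfolding F_def by measurable
    show "(\<lambda>n. F n z) sums dilation a b m B d h s z" for z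
    proof -
      have "(\<lambda>n. P z * (q n * (of_real s * (z - B)) ^ n))
          sums (P z * (exp (d * (of_real s * (z - B))) * h (B + of_real s * (z - B))))"
        by (intro sums_mult q)
      moreover have "P z * (exp (d * (of_real s * (z - B))) * h (B + of_real s * (z - B))) = dilation a b m B d h s z"
      proof -
        have "exp (- (d * (z - B))) * exp (d * (of_real s * (z - B))) = exp (- (of_real (1 - s) * d * (z - B)))"
          by (simp add: algebra_simps flip: exp_add)
        moreover have "B + of_real s * (z - B) = of_real s * z + of_real (1 - s) * B"
          by (simp add: algebra_simps)
        ultimately show ?thesis
          unfolding dilation_def P_def by (simp only: mult.assoc[symmetric]) (simp only: mult.assoc)
      qed
      ultimately show ?thesis by (simp add: F_def power_mult_distrib mult_ac)
    qed
    show "(\<Sum>n<N. cmod (F n z)) \<le> cmod (W z)" for N z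
    proof -
      have "(\<Sum>n<N. cmod (F n z)) = cmod (P z) * (\<Sum>n<N. cmod (q n) * (s * cmod (z - B)) ^ n)"
        using s by (simp add: F_def norm_mult norm_power power_mult_distrib sum_distrib_left mult_ac)
      also have "\<dots> \<le> cmod (P z) * (\<Sum>n<N. Y z * \<sigma> ^ n)"
        by (intro mult_left_mono sum_mono cauchy) auto
      also have "\<dots> \<le> cmod (P z) * (Y z * (1 / (1 - \<sigma>)))"
      proof -
        have "(\<Sum>n<N. \<sigma> ^ n) \<le> 1 / (1 - \<sigma>)"
          using sg sum_le_suminf[of "\<lambda>n. \<sigma> ^ n" "{..<N}"] suminf_geometric[of \<sigma>] summable_geometric[of \<sigma>] by simp
        then show ?thesis
          unfolding sum_distrib_left[symmetric] using Y0[of z] by (intro mult_left_mono) auto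
      qed
      finally show ?thesis by (simp add: norm_W)
    qed
    show "W \<in> gaussian_L2"
    proof (rule gaussian_L2_growth[OF _ s(2)])
      show "W \<in> borel_measurable borel" unfolding W_def Y_def \<rho>_def by measurable
      fix z
      have "cmod d * \<rho> z + (cmod B + \<rho> z)\<^sup>2 / 2
          \<le> (cmod d * \<beta> + (cmod B)\<^sup>2 / 2 + cmod B * \<beta> + \<beta>\<^sup>2 / 2) + (cmod d + cmod B + \<beta>) * cmod z + s / 2 * (cmod z)\<^sup>2"
      proof -
        have 1: "cmod d * \<rho> z \<le> cmod d * (cmod z + \<beta>)" "cmod B * \<rho> z \<le> cmod B * (cmod z + \<beta>)"
          by (auto intro!: mult_left_mono \<rho>(2))
        have b0: "\<beta> \<ge> 0" by (simp add: \<beta>_def)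
        have "s * (2 * \<beta> * cmod z + \<beta>\<^sup>2) \<le> 1 * (2 * \<beta> * cmod z + \<beta>\<^sup>2)"
          using s b0 by (intro mult_right_mono) auto
        then have "(\<rho> z)\<^sup>2 \<le> s * (cmod z)\<^sup>2 + 2 * \<beta> * cmod z + \<beta>\<^sup>2"
          using \<rho>(3)[of z] by (simp add: power2_sum algebra_simps)
        then have "(cmod B + \<rho> z)\<^sup>2 / 2 \<le> (cmod B)\<^sup>2 / 2 + cmod B * (cmod z + \<beta>) + (s * (cmod z)\<^sup>2 + 2 * \<beta> * cmod z + \<beta>\<^sup>2) / 2"
          using 1(2) power2_sum[of "cmod B" "\<rho> z"] by (simp only: mult.assoc) argo
        with 1(1) show ?thesis by (simp add: algebra_simps add_divide_distrib)
      qed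
      then have "Y z \<le> K * exp ((cmod d * \<beta> + (cmod B)\<^sup>2 / 2 + cmod B * \<beta> + \<beta>\<^sup>2 / 2) + (cmod d + cmod B + \<beta>) * cmod z + s / 2 * (cmod z)\<^sup>2)"
        unfolding Y_def using K(1) by (intro mult_left_mono) auto
      then have "Y z / (1 - \<sigma>) \<le> K * exp ((cmod d * \<beta> + (cmod B)\<^sup>2 / 2 + cmod B * \<beta> + \<beta>\<^sup>2 / 2) + (cmod d + cmod B + \<beta>) * cmod z + s / 2 * (cmod z)\<^sup>2) / (1 - \<sigma>)"
        using sg by (intro divide_right_mono) auto
      then have "cmod (P z) * (Y z / (1 - \<sigma>)) \<le> (L * exp (\<kappa> * cmod z)) *
          (K * exp ((cmod d * \<beta> + (cmod B)\<^sup>2 / 2 + cmod B * \<beta> + \<beta>\<^sup>2 / 2) + (cmod d + cmod B + \<beta>) * cmod z + s / 2 * (cmod z)\<^sup>2) / (1 - \<sigma>))"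
        using sg Y0[of z] by (intro mult_mono L order_trans[OF norm_ge_zero L]) auto
      also have "\<dots> = (L * K / (1 - \<sigma>) * exp (cmod d * \<beta> + (cmod B)\<^sup>2 / 2 + cmod B * \<beta> + \<beta>\<^sup>2 / 2)) *
          exp ((\<kappa> + cmod d + cmod B + \<beta>) * cmod z + s / 2 * (cmod z)\<^sup>2)"
        by (simp add: exp_add ring_distribs)
      finally show "cmod (W z) \<le> (L * K / (1 - \<sigma>) * exp (cmod d * \<beta> + (cmod B)\<^sup>2 / 2 + cmod B * \<beta> + \<beta>\<^sup>2 / 2)) *
          exp ((\<kappa> + cmod d + cmod B + \<beta>) * cmod z + s / 2 * (cmod z)\<^sup>2)"
        by (simp only: norm_W)
    qed
  qed
  then show ?thesis
    unfolding F_def fock_inner_scale_right by (simp add: P_def)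
qed

section \<open>The candidate lies in the adjoint\<close>

text \<open>
  Both sides of the adjoint relation, evaluated on dilations with parameter \<open>s < 1\<close>, are power series in
  \<open>s\<close>. Their coefficients pair \<open>u\<close> with \<open>z\<^sup>n\<^sup>+\<^sup>m\<close> and \<open>v\<close> with
  \<open>(a z + b)\<^sup>m exp (- d (z - B)) (z - B)\<^sup>n\<close>, and comparing Taylor coefficients in the equation that
  relates \<open>u\<close> and \<open>v\<close> shows that they agree up to the shift by \<open>m\<close>. Letting \<open>s\<close> tend to \<open>1\<close> gives
  the relation itself.
\<close>

lemma S_hat_max_subset_adjoint:
  assumes a: "a \<noteq> 0" and C: "C \<noteq> 0" and A: "A \<noteq> 0"
  shows "S_hat_max m a b (\<lambda>z. cnj C * exp (cnj B * z)) (\<lambda>z. cnj A * z + cnj D) (\<lambda>z. (cnj A * z + cnj D) ^ m)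
    \<subseteq> mv_adjoint
     (S_max m (\<lambda>z. C * exp (D * z)) (\<lambda>z. A * z + B) (\<lambda>z. (a * A * z + a * B + b) ^ m))"
  (is "?T \<subseteq> mv_adjoint ?S")
proof clarify
  fix u v assume uv: "(u, v) \<in> ?T"
  then have u: "u \<in> fock_space" and v: "v \<in> fock_space" by (auto simp: S_hat_max_def)
  define d where "d = D / A"
  define P where "P z = (a * z + b) ^ m * exp (- (d * (z - B)))" for z
  have P: "exponential_type P"
  proof -
    have "P = (\<lambda>z. (a * z + b) ^ m * exp (- d * z + d * B))"
      by (simp add: fun_eq_iff P_def algebra_simps)
    then show ?thesis by (simp only: exponential_type_intros)
  qed
  define c where "c n = fock_inner v (\<lambda>z. P z * (z - B) ^ n)" for n
  define e where "e n = fock_inner u (\<lambda>z. z ^ n)" for n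
  have u_eq: "cnj C * u y = y ^ m * fock_inner v (\<lambda>z. P z * exp (cnj (y / cnj A) * (z - B)))" for y
  proof -
    \<comment> \<open>The point at which the symbol \<open>cnj A w + cnj D\<close> takes the value \<open>y\<close>.\<close>
    define w where "w = y / cnj A - cnj d"
    have y: "cnj A * w + cnj D = y"
      using A by (simp add: w_def d_def field_simps)
    have "cnj C * exp (cnj B * w) * u y = y ^ m * fock_inner v (\<lambda>z. (a * z + b) ^ m * exp (cnj w * z))"
      using uv unfolding fock_inner_affine_power[OF v] by (auto simp: S_hat_max_def y dest: spec[of _ w])
    then have "cnj C * u y = exp (- (cnj B * w)) * (y ^ m * fock_inner v (\<lambda>z. (a * z + b) ^ m * exp (cnj w * z)))"
      by (simp add: exp_minus field_simps)
    also have "\<dots> = y ^ m * fock_inner v (\<lambda>z. exp (- (B * cnj w)) * ((a * z + b) ^ m * exp (cnj w * z)))"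
      unfolding fock_inner_scale_right by (simp add: exp_cnj)
    also have "(\<lambda>z. exp (- (B * cnj w)) * ((a * z + b) ^ m * exp (cnj w * z)))
        = (\<lambda>z. P z * exp (cnj (y / cnj A) * (z - B)))"
    proof
      fix z
      have "exp (- (B * cnj w)) * exp (cnj w * z) = exp (- (d * (z - B))) * exp (cnj (y / cnj A) * (z - B))"
        by (simp add: w_def algebra_simps diff_divide_distrib flip: exp_add)
      then show "exp (- (B * cnj w)) * ((a * z + b) ^ m * exp (cnj w * z)) = P z * exp (cnj (y / cnj A) * (z - B))"
        by (simp add: P_def mult_ac)
    qed
    finally show ?thesis .
  qed
  have coeff: "(\<lambda>k. cnj C * (e k / fact k)) = (\<lambda>k. if k < m then 0 else c (k - m) / fact (k - m) * (1 / cnj A) ^ (k - m))"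
  proof (rule entire_powser_unique[where f="\<lambda>y. cnj C * u y"])
    fix y
    show "(\<lambda>k. cnj C * (e k / fact k) * y ^ k) sums (cnj C * u y)"
      using sums_mult[OF fock_inner_exp_series[OF fock_space_L2[OF u] exponential_type_const[of 1], of 0 y], of "cnj C"]
      using fock_reproducing[OF u, of y] by (simp add: e_def mult_ac)
    let ?f = "\<lambda>k. (if k < m then 0 else c (k - m) / fact (k - m) * (1 / cnj A) ^ (k - m)) * y ^ k"
    have "(\<lambda>n. y ^ m * (c n / fact n * (y / cnj A) ^ n)) sums (cnj C * u y)"
      unfolding u_eq c_def by (intro sums_mult fock_inner_exp_series fock_space_L2 v P)
    then have "(\<lambda>n. ?f (n + m)) sums (cnj C * u y)"
      by (simp add: power_add power_divide mult_ac)
    then show "?f sums (cnj C * u y)"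
      by (subst (asm) sums_zero_iff_shift) auto
  qed
  have e_low: "e k = 0" if "k < m" for k
    using fun_cong[OF coeff, of k] that C by simp
  have e_high: "cnj C * cnj A ^ n * e (n + m) = fact (n + m) / fact n * c n" for n
    using fun_cong[OF coeff, of "n + m"] A by (simp add: field_simps)
  have "fock_inner g u = fock_inner f v" if fg: "(f, g) \<in> ?S" for f g
  proof -
    have f: "f \<in> fock_space" and g: "g \<in> fock_space"
      and rel: "\<And>z. C * exp (D * z) * f (A * z + B) = (a * A * z + a * B + b) ^ m * (deriv ^^ m) g z"
      using fg by (auto simp: S_max_def)
    define G where "G = (deriv ^^ m) g"
    have G: "G holomorphic_on UNIV"
      unfolding G_def by (intro holomorphic_higher_deriv fock_space_entire g) auto
    \<comment> \<open>The equation of the graph, solved for the entire cofactor of \<open>(a y + b) ^ m\<close> in \<open>f y\<close>.\<close>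
    define h where "h y = exp (- (d * (y - B))) * G (1 / A * y + - (B / A)) / C" for y
    have h: "h holomorphic_on UNIV"
      unfolding h_def using C by (intro holomorphic_intros entire_affine[OF G]) auto
    have fh: "f = (\<lambda>y. (a * y + b) ^ m * h y)"
    proof
      fix y
      define z where "z = 1 / A * y + - (B / A)"
      have z: "A * z + B = y" "a * A * z + a * B + b = a * y + b"
        using A by (auto simp: z_def field_simps)
      have Dz: "D * z = d * (y - B)" by (simp add: z_def d_def algebra_simps diff_divide_distrib)
      define x where "x = d * (y - B)"
      have "C * exp x * f y = (a * y + b) ^ m * G z"
        using rel[of z] by (simp only: z Dz G_def x_def)
      moreover have "h y = exp (- x) * G z / C" by (simp only: h_def z_def x_def)
      then have "G z = C * exp x * h y" using C by (simp add: exp_minus field_simps)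
      ultimately have "(C * exp x) * f y = (C * exp x) * ((a * y + b) ^ m * h y)"
        by (simp add: mult_ac)
      then show "f y = (a * y + b) ^ m * h y" using C by simp
    qed
    have h_fock: "h \<in> fock_space"
    proof -
      note [measurable] = entire_borel_measurable[OF h]
      have "(\<lambda>z. of_real ((1 + cmod z) ^ m) * h z) \<in> gaussian_L2"
        using f fh by (intro gaussian_L2_cofactor[OF h a]) (auto dest: fock_space_L2)
      then have "h \<in> gaussian_L2"
      proof (rule gaussian_L2_bound[rotated])
        fix z
        have "1 * cmod (h z) \<le> (1 + cmod z) ^ m * cmod (h z)"
          by (intro mult_right_mono one_le_power) auto
        then show "cmod (h z) \<le> cmod (of_real ((1 + cmod z) ^ m) * h z)"
          by (simp add: norm_mult norm_power flip: of_real_power)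
      qed measurable
      with h show ?thesis by (simp add: fock_space_iff)
    qed
    \<comment> \<open>Taylor coefficients of \<open>g\<close> at \<open>0\<close>, and of \<open>exp (d t) h (B + t) = G (t / A) / C\<close>.\<close>
    define g' where "g' n = (deriv ^^ n) g 0 / fact n" for n
    define q where "q n = (deriv ^^ n) G 0 / fact n * (1 / A) ^ n / C" for n
    have q_sums: "(\<lambda>n. q n * t ^ n) sums (exp (d * t) * h (B + t))" for t
    proof -
      have "(\<lambda>n. (deriv ^^ n) G 0 / fact n * (t / A) ^ n / C) sums (G (0 + t / A) / C)"
        by (intro sums_divide entire_taylor_sums G)
      moreover have "exp (d * t) * h (B + t) = G (0 + t / A) / C"
      proof -
        have "1 / A * (B + t) + - (B / A) = t / A" by (simp add: add_divide_distrib)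
        then show ?thesis by (simp add: h_def exp_minus)
      qed
      ultimately show ?thesis by (simp add: q_def power_divide mult_ac)
    qed
    have q_g': "cnj (q n) * c n = cnj (g' (n + m)) * e (n + m)" for n
    proof -
      have "C * A ^ n * q n * fact n = g' (n + m) * fact (n + m)"
        using A C by (simp add: q_def g'_def G_def funpow_add power_divide)
      then have "cnj (C * A ^ n * q n * fact n) = cnj (g' (n + m) * fact (n + m))" by simp
      then have 1: "cnj C * cnj A ^ n * cnj (q n) * fact n = cnj (g' (n + m)) * fact (n + m)" by simp
      have 2: "cnj C * cnj A ^ n * e (n + m) * fact n = fact (n + m) * c n"
        using e_high[of n] by simp
      have "(cnj C * cnj A ^ n * cnj (q n) * fact n) * (fact (n + m) * c n)
          = (cnj (g' (n + m)) * fact (n + m)) * (cnj C * cnj A ^ n * e (n + m) * fact n)"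
        by (simp only: 1 2)
      then have "(cnj C * cnj A ^ n * fact n * fact (n + m)) * (cnj (q n) * c n)
          = (cnj C * cnj A ^ n * fact n * fact (n + m)) * (cnj (g' (n + m)) * e (n + m))"
        by (simp only: mult_ac)
      then show ?thesis using A C by simp
    qed
    have eq_s: "fock_inner u (dilation 1 0 0 0 0 g s) = of_real s ^ m * fock_inner v (dilation a b m B d h s)"
      if s: "0 < s" "s < 1" for s
    proof -
      have "(\<lambda>n. g' n * t ^ n) sums (exp (0 * t) * g (0 + t))" for t
        using entire_taylor_sums[OF fock_space_entire[OF g], of 0 t] by (simp add: g'_def)
      from dilation_series[OF fock_space_L2[OF u] g s this, of 1 0 0]
      have "(\<lambda>n. cnj (g' n) * of_real s ^ n * e n) sums fock_inner u (dilation 1 0 0 0 0 g s)"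
        by (simp add: e_def)
      then have "(\<lambda>n. cnj (g' (n + m)) * of_real s ^ (n + m) * e (n + m)) sums fock_inner u (dilation 1 0 0 0 0 g s)"
        by (subst sums_zero_iff_shift) (auto simp: e_low)
      moreover have "cnj (g' (n + m)) * of_real s ^ (n + m) * e (n + m) = of_real s ^ m * (cnj (q n) * of_real s ^ n * c n)" for n
        using q_g'[of n] by (simp add: power_add mult_ac)
      moreover have "(\<lambda>n. of_real s ^ m * (cnj (q n) * of_real s ^ n * c n)) sums (of_real s ^ m * fock_inner v (dilation a b m B d h s))"
        using dilation_series[OF fock_space_L2[OF v] h_fock s q_sums, of a b m]
        by (intro sums_mult) (simp add: c_def P_def)
      ultimately show ?thesis
        by (simp add: sums_unique2)
    qed
    define s where "s n = 1 - 1 / (real n + 2)" for n :: nat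
    have s: "0 < s n" "s n < 1" for n by (auto simp: s_def field_simps)
    have s_lim: "s \<longlonglongrightarrow> 1" unfolding s_def by real_asymp
    have "(\<lambda>n. fock_inner u (dilation 1 0 0 0 0 g (s n))) \<longlonglongrightarrow> fock_inner u (\<lambda>z. (1 * z + 0) ^ 0 * g z)"
      unfolding s_def using g
      by (intro dilation_limit fock_space_L2 u fock_space_entire) auto
    then have "(\<lambda>n. fock_inner u (dilation 1 0 0 0 0 g (s n))) \<longlonglongrightarrow> fock_inner u g" by simp
    moreover have "(\<lambda>n. of_real (s n) ^ m * fock_inner v (dilation a b m B d h (s n)))
        \<longlonglongrightarrow> of_real 1 ^ m * fock_inner v f"
    proof (intro tendsto_intros s_lim)
      show "(\<lambda>n. fock_inner v (dilation a b m B d h (s n))) \<longlonglongrightarrow> fock_inner v f"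
        unfolding s_def fh using f fh
        by (intro dilation_limit fock_space_L2 v h a) auto
    qed
    ultimately have "fock_inner u g = fock_inner v f"
      using eq_s[OF s] LIMSEQ_unique by simp
    then show ?thesis using fock_inner_cnj by metis
  qed
  with u v show "(u, v) \<in> mv_adjoint ?S" by (auto simp: mv_adjoint_def)
qed

text \<open>
  For \<open>A = 0\<close> and \<open>m = 0\<close> the second component of a pair is a scalar multiple of a fixed kernel on both
  sides, and the reproducing property evaluates both inner products.
\<close>

lemma S_hat_max_subset_adjoint_degenerate:
  "S_hat_max 0 a b (\<lambda>z. cnj C * exp (cnj B * z)) (\<lambda>z. cnj D) (\<lambda>z. 1)
    \<subseteq> mv_adjoint (S_max 0 (\<lambda>z. C * exp (D * z)) (\<lambda>z. B) (\<lambda>z. 1))"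
proof clarify
  fix u v assume uv: "(u, v) \<in> S_hat_max 0 a b (\<lambda>z. cnj C * exp (cnj B * z)) (\<lambda>z. cnj D) (\<lambda>z. 1)"
  then have u: "u \<in> fock_space" and v: "v \<in> fock_space" by (auto simp: S_hat_max_def)
  have v_eq: "v = (\<lambda>z. (cnj C * u (cnj D)) * exp (cnj B * z))"
    using uv by (auto simp: S_hat_max_def fun_eq_iff mult_ac)
  have "fock_inner g u = fock_inner f v"
    if "(f, g) \<in> S_max 0 (\<lambda>z. C * exp (D * z)) (\<lambda>z. B) (\<lambda>z. 1)" for f g
  proof -
    have f: "f \<in> fock_space" and g_eq: "g = (\<lambda>z. (C * f B) * exp (D * z))"
      using that by (auto simp: S_max_def fun_eq_iff mult_ac)
    have "fock_inner g u = C * f B * cnj (fock_inner u (\<lambda>z. exp (cnj (cnj D) * z)))"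
      unfolding g_eq fock_inner_scale_left by (simp add: fock_inner_cnj)
    also have "\<dots> = C * f B * cnj (u (cnj D))"
      by (simp only: fock_reproducing[OF u])
    also have "\<dots> = fock_inner f v"
      unfolding v_eq fock_inner_scale_right fock_reproducing[OF f] by simp
    finally show ?thesis .
  qed
  with u v show "(u, v) \<in> mv_adjoint (S_max 0 (\<lambda>z. C * exp (D * z)) (\<lambda>z. B) (\<lambda>z. 1))"
    by (auto simp: mv_adjoint_def)
qed

theorem theorem4p1:
  fixes m :: nat and a b c A B C D :: complex
  assumes "cmod a = 1"
    and "cnj a * b + cnj b = 0"
    and "(cmod c)\<^sup>2 * exp ((cmod b)\<^sup>2) = 1"
    and "C \<noteq> 0"
    and nondeg: "A \<noteq> 0 \<or> m = 0"
  shows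
    "mv_adjoint
       (S_max m
          (\<lambda>z. C * exp (D * z))
          (\<lambda>z. A * z + B)
          (\<lambda>z. (a * A * z + a * B + b) ^ m))
     = S_hat_max m a b
          (\<lambda>z. cnj C * exp (cnj B * z))
          (\<lambda>z. cnj A * z + cnj D)
          (\<lambda>z. (cnj A * z + cnj D) ^ m)"
proof (rule antisym[OF adjoint_subset_S_hat_max])
  have a: "a \<noteq> 0" using assms(1) by auto
  show "S_hat_max m a b (\<lambda>z. cnj C * exp (cnj B * z)) (\<lambda>z. cnj A * z + cnj D) (\<lambda>z. (cnj A * z + cnj D) ^ m)
    \<subseteq> mv_adjoint (S_max m (\<lambda>z. C * exp (D * z)) (\<lambda>z. A * z + B) (\<lambda>z. (a * A * z + a * B + b) ^ m))"
  proof (cases "A = 0")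
    case True
    then show ?thesis using nondeg S_hat_max_subset_adjoint_degenerate by simp
  next
    case False
    then show ?thesis by (rule S_hat_max_subset_adjoint[OF a assms(4)])
  qed
qed

end
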